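(* Let $n\ge1$ be an integer, let $\alpha>-1$ be real with $\alpha\neq0,1,2,\ldots$, and let $w(t)=t^\alpha e^{-t}$. Let $f$ be a function on $[0,\infty)$ that is Hölder-continuous in every finite interval $[0,a]$, $a>0$, and satisfies $|f(x)|\le Ce^{\beta x}$ as $x\to\infty$ with constants $C$ and $\beta<1$. Put $$I^\alpha[f](x)=\frac1\pi\int_0^\infty\frac{f(t)w(t)\,dt}{t-x},\qquad 0<x<\infty .$$ Let $x_1,\ldots,x_n$ be the zeros of the Laguerre polynomial $L_n^\alpha$, and let $$\gamma_m=-\frac{x_m}{(n+\alpha)L_{n-1}^\alpha(x_m)},\qquad Q_n^\alpha(x)=\frac{\Gamma(\alpha)}{\pi}e^{-x}\,\Phi(-n-\alpha,1-\alpha;x)-\cot(\pi\alpha)\,x^\alpha e^{-x}L_n^\alpha(x).$$ Define the remainder $R_n$ by $$I^\alpha[f](x)=\sum_{m=1}^n\gamma_mf(x_m)\frac{Q_n^\alpha(x)-Q_n^\alpha(x_m)}{x-x_m}+R_n(x),\qquad 0<x<\infty,\ x\ne x_m,$$ and, for $x=x_j$, by $$I^\alpha[f](x_j)=\gamma_jf(x_j)\frac{dQ_n^\alpha}{dx}(x_j)+\sum_{m=1,\,m\ne j}^n\gamma_mf(x_m)\frac{Q_n^\alpha(x_j)-Q_n^\alpha(x_m)}{x_j-x_m}+R_n(x_j).$$ Then: (i) $$\frac{dQ_n^\alpha}{dx}(x_j)=\frac1\pi e^{-x_j}\Gamma(\alpha)\left[\frac{n+\alpha}{\alpha-1}\Phi(-n-\alpha+1,2-\alpha;x_j)-\Phi(-n-\alpha,1-\alpha;x_j)\right]+\cot(\pi\alpha)\,x_j^{\alpha-1}e^{-x_j}(n+\alpha)L_{n-1}^\alpha(x_j).$$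 (ii) If $f$ is a polynomial of degree not higher than $n-1$, then $R_n(x)\equiv0$, i.e. the quadrature formula is exact. (iii) Otherwise, if $f(x)=M_{n-1}(x)+r(x)$ where $M_{n-1}$ is a polynomial of degree $n-1$, then for $0<x<\infty$, $x\neq x_m$, $$R_n(x)=-\sum_{m=1}^n\frac{\gamma_m r(x_m)}{x-x_m}\left[Q_n^\alpha(x)-Q_n^\alpha(x_m)\right]+\frac1\pi\int_0^\infty\frac{r(t)w(t)\,dt}{t-x}.$$
   Context: Singular integrals are Cauchy principal values. $L_n^\alpha(x)=\sum_{k=0}^n\binom{n+\alpha}{n-k}\frac{(-1)^kx^k}{k!}$ are the (generalized) Laguerre polynomials, with $\binom{a}{n}=\frac{\Gamma(a+1)}{n!\,\Gamma(a-n+1)}$; for $\alpha>-1$ the polynomial $L_n^\alpha$ has $n$ distinct zeros, all in $(0,\infty)$. $\Phi(a,c;x)=\sum_{k=0}^\infty \frac{(a)_k x^k}{(c)_k k!}$ is the confluent hypergeometric function, $(a)_k=a(a+1)\cdots(a+k-1)$. *)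

theory Defs
  imports "HOL-Analysis.Analysis" "HOL-Computational_Algebra.Polynomial"
begin

definition holder_continuous_on :: "real set \<Rightarrow> (real \<Rightarrow> real) \<Rightarrow> bool" where
  "holder_continuous_on S f \<longleftrightarrow>
     (\<exists>\<mu> A. 0 < \<mu> \<and> \<mu> \<le> 1 \<and>
        (\<forall>x\<in>S. \<forall>y\<in>S. \<bar>f x - f y\<bar> \<le> A * \<bar>x - y\<bar> powr \<mu>))"

text \<open>
  Cauchy principal value, at the singularity \<open>x\<close>, of an integral over the half-line
  from \<open>0\<close> to infinity. Only values of \<open>g\<close> on the half-line enter.
  The value is unspecified if the limit does not exist.
\<close>
definition pv_integral :: "(real \<Rightarrow> real) \<Rightarrow> real \<Rightarrow> real" where
  "pv_integral g x =
     Lim (at_right 0) (\<lambda>\<epsilon>. (LINT t:{0..x - \<epsilon>}|lborel. g t) + (LINT t:{x + \<epsilon>..}|lborel. g t))"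

definition laguerre_weight :: "real \<Rightarrow> real \<Rightarrow> real" where
  "laguerre_weight \<alpha> t = t powr \<alpha> * exp (- t)"

definition singular_integral :: "real \<Rightarrow> (real \<Rightarrow> real) \<Rightarrow> real \<Rightarrow> real" where
  "singular_integral \<alpha> f x =
     1 / pi * pv_integral (\<lambda>t. f t * laguerre_weight \<alpha> t / (t - x)) x"

text \<open>
  For \<open>\<alpha> > -1\<close> the generalized binomial coefficients below agree with their
  expression by Gamma functions, see \<open>gbinomial_Gamma\<close>.
\<close>
definition laguerre :: "nat \<Rightarrow> real \<Rightarrow> real \<Rightarrow> real" where
  "laguerre n \<alpha> x =
     (\<Sum>k=0..n. ((real n + \<alpha>) gchoose (n - k)) * ((- 1) ^ k * x ^ k) / fact k)"

text \<open>The confluent hypergeometric function \<open>\<Phi>(a,c;x)\<close>, for \<open>c\<close> not in \<open>{0,-1,-2,\<dots>}\<close>.\<close>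
definition confluent_hyp :: "real \<Rightarrow> real \<Rightarrow> real \<Rightarrow> real" where
  "confluent_hyp a c x = (\<Sum>k. pochhammer a k * x ^ k / (pochhammer c k * fact k))"

definition quad_weight :: "nat \<Rightarrow> real \<Rightarrow> real \<Rightarrow> real" where
  "quad_weight n \<alpha> z = - z / ((real n + \<alpha>) * laguerre (n - 1) \<alpha> z)"

definition laguerre_Q :: "nat \<Rightarrow> real \<Rightarrow> real \<Rightarrow> real" where
  "laguerre_Q n \<alpha> x =
     Gamma \<alpha> / pi * exp (- x) * confluent_hyp (- real n - \<alpha>) (1 - \<alpha>) x
     - cot (pi * \<alpha>) * x powr \<alpha> * exp (- x) * laguerre n \<alpha> x"

end

theory Submission
  imports Defs "HOL-Real_Asymp.Real_Asymp"
begin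

text \<open>
  The key fact is that \<open>\<pi> Q\<^sub>n(x)\<close> is the principal value of the integral of \<open>L\<^sub>n(t) w(t) / (t - x)\<close>.
  Both quantities satisfy the three-term recurrence of the Laguerre polynomials (for \<open>Q\<^sub>n\<close> this is a
  contiguous relation of \<open>\<Phi>\<close>), which reduces the claim to \<open>n = 0\<close>; shifting \<open>\<alpha>\<close> by \<open>1\<close>
  reduces it further to \<open>-1 < \<alpha> < 0\<close>. There
  \<open>e\<^sup>x w(t) / (t - x)\<close> is the sum of \<open>t\<^sup>\<alpha> / (t - x)\<close>, whose principal value
  \<open>- \<pi> cot(\<pi> \<alpha>) x\<^sup>\<alpha>\<close> comes from the partial fractions of the cotangent, and of a regular integrand
  that is evaluated by Fubini's theorem.

  A polynomial of degree less than \<open>n\<close> is its Lagrange interpolant at the nodes, and partial fractions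
  of \<open>1 / ((t - x\<^sub>m) (t - x))\<close> turn the principal values of the basis polynomials
  \<open>L\<^sub>n(t) / (t - x\<^sub>m)\<close> into divided differences of \<open>Q\<^sub>n\<close>. This is (ii), and (iii) follows by linearity.
\<close>

section \<open>Principal values\<close>

text \<open>The strip -1 < \<alpha> < 0 is where the splitting into kernels works without the
  exponential: \<open>t powr \<alpha> / (t - x)\<close> is integrable at 0 because \<alpha> > -1 and
  at infinity because \<alpha> < 0. The same inequality \<alpha> < 0 makes
  \<open>s powr (- \<alpha> - 1)\<close>, which the inner Gamma integral produces, integrable at s =
  0. For \<alpha> > 0 both pieces diverge although their combination converges, so larger \<alpha>
  has to be reached algebraically.

  In the strip the regular integrand is nonnegative, so the exchange of integrals costs nothing. The
  cotangent appears because folding the two sides of \<open>x\<close> onto the unit interval leaves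
  the difference of the powers -\<alpha> - 1 and \<alpha> over 1 - v, whose geometric expansion
  integrates termwise to the partial fractions.

  Two points need more than algebra. At a node the divided difference becomes a derivative, and the
  principal values are known there only as limits, so they are produced as continuous functions of
  \<open>x\<close>. And (iii) subtracts principal values, which presupposes that the one of
  \<open>f\<close> exists; this is where Hoelder continuity and growth enter.\<close>

text \<open>Integrability is part of the notion: the integral of a non-integrable function is \<open>0\<close>,
  which would destroy additivity.\<close>
definition has_pv :: "(real \<Rightarrow> real) \<Rightarrow> real \<Rightarrow> real \<Rightarrow> bool" where
  "has_pv g x L \<longleftrightarrow>
     (\<forall>\<epsilon>>0. set_integrable lborel {0..x - \<epsilon>} g \<and> set_integrable lborel {x + \<epsilon>..} g) \<and>
     ((\<lambda>\<epsilon>. (LINT t:{0..x - \<epsilon>}|lborel. g t) + (LINT t:{x + \<epsilon>..}|lborel. g t)) \<longlongrightarrow> L) (at_right 0)"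

lemma has_pv_pv_integral: "has_pv g x L \<Longrightarrow> pv_integral g x = L"
  unfolding has_pv_def pv_integral_def by (auto intro: tendsto_Lim)

lemma has_pv_unique: "has_pv g x L \<Longrightarrow> has_pv g x L' \<Longrightarrow> L = L'"
  using has_pv_pv_integral by metis

text \<open>The truncated domains lie in the half-line and avoid \<open>x\<close>. Algebraic
  identities between integrands therefore have to be checked only for \<open>t \<noteq> x\<close>,
  where division by \<open>t - x\<close> is genuine.\<close>

lemma has_pv_cong:
  assumes "has_pv g x L" "x > 0" "\<And>t. t \<ge> 0 \<Longrightarrow> t \<noteq> x \<Longrightarrow> g t = h t"
  shows "has_pv h x L"
proof -
  have i: "set_integrable lborel {0..x - \<epsilon>} h \<longleftrightarrow> set_integrable lborel {0..x - \<epsilon>} g"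
    "set_integrable lborel {x + \<epsilon>..} h \<longleftrightarrow> set_integrable lborel {x + \<epsilon>..} g"
    "(LINT t:{0..x - \<epsilon>}|lborel. h t) = (LINT t:{0..x - \<epsilon>}|lborel. g t)"
    "(LINT t:{x + \<epsilon>..}|lborel. h t) = (LINT t:{x + \<epsilon>..}|lborel. g t)"
    if "\<epsilon> > 0" for \<epsilon>
    by (rule set_integrable_cong; use that assms in auto)
      (rule set_integrable_cong set_lebesgue_integral_cong; use that assms in auto)+
  have "((\<lambda>\<epsilon>. (LINT t:{0..x - \<epsilon>}|lborel. h t) + (LINT t:{x + \<epsilon>..}|lborel. h t)) \<longlongrightarrow> L) (at_right 0)"
  proof (rule Lim_transform_eventually)
    show "((\<lambda>\<epsilon>. (LINT t:{0..x - \<epsilon>}|lborel. g t) + (LINT t:{x + \<epsilon>..}|lborel. g t)) \<longlongrightarrow> L) (at_right 0)"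
      using assms(1) unfolding has_pv_def by blast
    show "\<forall>\<^sub>F \<epsilon> in at_right 0. (LINT t:{0..x - \<epsilon>}|lborel. g t) + (LINT t:{x + \<epsilon>..}|lborel. g t)
        = (LINT t:{0..x - \<epsilon>}|lborel. h t) + (LINT t:{x + \<epsilon>..}|lborel. h t)"
      using eventually_at_right_less[of "0::real"] by eventually_elim (simp add: i)
  qed
  then show ?thesis
    using assms(1) i unfolding has_pv_def by blast
qed

lemma has_pv_cmult:
  assumes "has_pv g x L"
  shows "has_pv (\<lambda>t. c * g t) x (c * L)"
proof -
  have "((\<lambda>\<epsilon>. c * ((LINT t:{0..x - \<epsilon>}|lborel. g t) + (LINT t:{x + \<epsilon>..}|lborel. g t))) \<longlongrightarrow> c * L) (at_right 0)"
    using assms unfolding has_pv_def by (intro tendsto_mult_left) auto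
  then show ?thesis
    using assms unfolding has_pv_def by (simp add: distrib_left)
qed

lemma has_pv_add:
  assumes "has_pv g x L" "has_pv h x M"
  shows "has_pv (\<lambda>t. g t + h t) x (L + M)"
proof -
  have "((\<lambda>\<epsilon>. (LINT t:{0..x - \<epsilon>}|lborel. g t + h t) + (LINT t:{x + \<epsilon>..}|lborel. g t + h t)) \<longlongrightarrow> L + M) (at_right 0)"
  proof (rule Lim_transform_eventually)
    show "((\<lambda>\<epsilon>. ((LINT t:{0..x - \<epsilon>}|lborel. g t) + (LINT t:{x + \<epsilon>..}|lborel. g t)) +
        ((LINT t:{0..x - \<epsilon>}|lborel. h t) + (LINT t:{x + \<epsilon>..}|lborel. h t))) \<longlongrightarrow> L + M) (at_right 0)"
      using assms unfolding has_pv_def by (intro tendsto_add) auto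
    show "\<forall>\<^sub>F \<epsilon> in at_right 0. ((LINT t:{0..x - \<epsilon>}|lborel. g t) + (LINT t:{x + \<epsilon>..}|lborel. g t)) +
        ((LINT t:{0..x - \<epsilon>}|lborel. h t) + (LINT t:{x + \<epsilon>..}|lborel. h t))
       = (LINT t:{0..x - \<epsilon>}|lborel. g t + h t) + (LINT t:{x + \<epsilon>..}|lborel. g t + h t)"
      using eventually_at_right_less[of "0::real"]
      by eventually_elim (use assms in \<open>auto simp: has_pv_def\<close>)
  qed
  then show ?thesis
    using assms unfolding has_pv_def by auto
qed

lemma has_pv_diff:
  assumes "has_pv g x L" "has_pv h x M"
  shows "has_pv (\<lambda>t. g t - h t) x (L - M)"
  using has_pv_add[OF assms(1) has_pv_cmult[OF assms(2), of "-1"]] by simp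

lemma has_pv_0: "has_pv (\<lambda>t. 0) x 0"
  unfolding has_pv_def by (auto simp: set_integrable_def)

lemma has_pv_sum:
  assumes "\<And>i. i \<in> I \<Longrightarrow> has_pv (g i) x (L i)"
  shows "has_pv (\<lambda>t. \<Sum>i\<in>I. g i t) x (\<Sum>i\<in>I. L i)"
  using assms by (induction I rule: infinite_finite_induct) (auto intro: has_pv_0 has_pv_add)

text \<open>The truncated domains increase to the half-line without the null set \<open>{x}\<close>
  as \<epsilon> decreases, and the integral is continuous along increasing sets. All regular parts
  split off from a singular integrand enter through this fact.\<close>

lemma has_pv_integrable:
  assumes g: "set_integrable lborel {0..} g" and x: "x > 0"
  shows "has_pv g x (LINT t:{0..}|lborel. g t)"
proof -
  have sub: "set_integrable lborel A g" if "A \<subseteq> {0..}" "A \<in> sets borel" for A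
    by (rule set_integrable_subset[OF g]) (use that in auto)
  have "((\<lambda>\<epsilon>. (LINT t:{0..x - \<epsilon>}|lborel. g t) + (LINT t:{x + \<epsilon>..}|lborel. g t)) \<longlongrightarrow> (LINT t:{0..}|lborel. g t)) (at_right 0)"
  proof (rule tendsto_at_right_sequentially[OF x])
    fix S :: "nat \<Rightarrow> real"
    assume S: "\<And>n. 0 < S n" "\<And>n. S n < x" "decseq S" "S \<longlonglongrightarrow> 0"
    let ?A = "\<lambda>n. {0..x - S n} \<union> {x + S n..}"
    have un: "(\<Union>n. ?A n) = {0..} - {x}"
    proof (intro equalityI subsetI)
      fix t assume "t \<in> (\<Union>n. ?A n)"
      then show "t \<in> {0..} - {x}" using S(1,2) x by auto (smt (verit, best))+
    next
      fix t assume t: "t \<in> {0..} - {x}"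
      then have "\<forall>\<^sub>F n in sequentially. S n < \<bar>t - x\<bar>"
        using order_tendstoD(2)[OF S(4)] by auto
      then obtain n where "S n < \<bar>t - x\<bar>" by (auto simp: eventually_sequentially)
      with t have "t \<in> ?A n" by auto
      then show "t \<in> (\<Union>n. ?A n)" by blast
    qed
    have "(\<lambda>n. LINT t:?A n|lborel. g t) \<longlonglongrightarrow> (LINT t:(\<Union>n. ?A n)|lborel. g t)"
    proof (rule set_integral_cont_up)
      show "incseq ?A"
        using S(3) by (fastforce simp: incseq_def decseq_def)
      show "set_integrable lborel (\<Union>n. ?A n) g" by (rule sub) (auto simp: un)
    qed auto
    moreover have "(LINT t:(\<Union>n. ?A n)|lborel. g t) = (LINT t:{0..}|lborel. g t)"
      unfolding un
      by (rule set_integral_discrete_difference[where X="{x}"]) auto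
    moreover have "(LINT t:?A n|lborel. g t) = (LINT t:{0..x - S n}|lborel. g t) + (LINT t:{x + S n..}|lborel. g t)" for n
      using S(1)[of n] x by (intro set_integral_Un sub) auto
    ultimately show "(\<lambda>n. (LINT t:{0..x - S n}|lborel. g t) + (LINT t:{x + S n..}|lborel. g t)) \<longlonglongrightarrow> (LINT t:{0..}|lborel. g t)"
      by simp
  qed
  then show ?thesis
    unfolding has_pv_def using x by (auto intro!: sub)
qed

text \<open>A gauge integral alone does not give Lebesgue integrability; for a nonnegative integrand
  it does, by way of the nonnegative integral.\<close>

lemma set_integrable_has_integral_nonneg:
  fixes f :: "real \<Rightarrow> real"
  assumes [measurable]: "f \<in> borel_measurable borel" "S \<in> sets borel"
    and "\<And>x. x \<in> S \<Longrightarrow> 0 \<le> f x" "(f has_integral I) S"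
  shows "set_integrable lborel S f" "(LINT t:S|lborel. f t) = I"
proof -
  have eq: "(\<integral>\<^sup>+x. ennreal (indicator S x * f x) \<partial>lborel) = ennreal I"
    using nn_integral_has_integral_lebesgue[of S f I] assms(3,4) by simp
  have I: "I \<ge> 0" using assms(3,4) has_integral_nonneg by blast
  have "has_bochner_integral lborel (\<lambda>x. indicator S x * f x) I"
    by (rule has_bochner_integral_nn_integral[OF _ _ I eq])
      (use assms(3) in \<open>auto simp: indicator_def\<close>)
  then show "set_integrable lborel S f" "(LINT t:S|lborel. f t) = I"
    unfolding set_integrable_def set_lebesgue_integral_def has_bochner_integral_iff by simp_all
qed

section \<open>Confluent hypergeometric functions and Laguerre polynomials\<close>

definition hyp_coeff :: "real \<Rightarrow> real \<Rightarrow> nat \<Rightarrow> real" where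
  "hyp_coeff a c k = pochhammer a k / (pochhammer c k * fact k)"

lemma confluent_hyp_altdef: "confluent_hyp a c x = (\<Sum>k. hyp_coeff a c k * x ^ k)"
  by (simp add: confluent_hyp_def hyp_coeff_def)

text \<open>Ratio test. If some \<open>pochhammer c k\<close> vanishes, all later coefficients are 0
  by division by zero, and the ratio identity persists.\<close>

lemma summable_hyp_coeff:
  fixes x :: real
  shows "summable (\<lambda>k. hyp_coeff a c k * x ^ k)"
proof -
  have "((\<lambda>k. \<bar>a + real k\<bar> * \<bar>x\<bar> / (\<bar>c + real k\<bar> * real (Suc k))) \<longlongrightarrow> 0) sequentially"
    by real_asymp
  then have "\<forall>\<^sub>F k in sequentially. \<bar>a + real k\<bar> * \<bar>x\<bar> / (\<bar>c + real k\<bar> * real (Suc k)) < 1/2"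
    by (rule order_tendstoD) simp
  then obtain N where N: "\<And>k. k \<ge> N \<Longrightarrow> \<bar>a + real k\<bar> * \<bar>x\<bar> / (\<bar>c + real k\<bar> * real (Suc k)) < 1/2"
    by (auto simp: eventually_sequentially)
  show ?thesis
  proof (rule summable_ratio_test[of "1/2" N])
    fix k assume "N \<le> k"
    have "hyp_coeff a c (Suc k) * x ^ Suc k
        = (a + real k) * x / ((c + real k) * real (Suc k)) * (hyp_coeff a c k * x ^ k)"
      by (simp add: hyp_coeff_def pochhammer_Suc mult_ac)
    then have "norm (hyp_coeff a c (Suc k) * x ^ Suc k)
        = \<bar>a + real k\<bar> * \<bar>x\<bar> / (\<bar>c + real k\<bar> * real (Suc k)) * norm (hyp_coeff a c k * x ^ k)"
      by (simp add: abs_mult)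
    also have "\<dots> \<le> 1/2 * norm (hyp_coeff a c k * x ^ k)"
      using N[OF \<open>N \<le> k\<close>] by (intro mult_right_mono) auto
    finally show "norm (hyp_coeff a c (Suc k) * x ^ Suc k) \<le> 1/2 * norm (hyp_coeff a c k * x ^ k)" .
  qed simp
qed

lemma confluent_hyp_sums: "(\<lambda>k. hyp_coeff a c k * x ^ k) sums confluent_hyp a c x"
  unfolding confluent_hyp_altdef by (rule summable_sums[OF summable_hyp_coeff])

lemma mult_confluent_hyp_sums:
  "(\<lambda>k. (if k = 0 then 0 else hyp_coeff a c (k - 1)) * x ^ k) sums (x * confluent_hyp a c x)"
  using sums_Suc[of "\<lambda>k. (if k = 0 then 0 else hyp_coeff a c (k - 1)) * x ^ k" "x * confluent_hyp a c x"]
    sums_mult[OF confluent_hyp_sums[of a c x], of x]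
  by (simp add: mult_ac)

lemma pochhammer_minus_1: "pochhammer (a - 1) (Suc k) = (a - 1) * pochhammer (a::real) k"
  using pochhammer_rec[of "a - 1" k] by simp

lemma pochhammer_plus_1: "a * pochhammer (a + 1) k = pochhammer (a::real) (Suc k)"
  using pochhammer_rec[of a k] by simp

text \<open>Over the common denominator of the coefficients of x^k, the factor
  \<open>pochhammer a j\<close> with j = k - 1 splits off and a polynomial identity remains. With c
  = \<alpha> + 1, a = -(n + 1) this is the recurrence of the Laguerre polynomials; with c = 1 -
  \<alpha>, a = -(n + 1) - \<alpha> it is that of the \<Phi> part of
  \<open>laguerre_Q\<close>.\<close>

lemma confluent_hyp_contiguous:
  assumes "c \<notin> \<int>\<^sub>\<le>\<^sub>0"
  shows "(c - a) * confluent_hyp (a - 1) c x + (2 * a - c + x) * confluent_hyp a c x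
    = a * confluent_hyp (a + 1) c x"
proof -
  have nz: "pochhammer c k \<noteq> 0" for k
    using assms by (auto simp: pochhammer_eq_0_iff)
  have coeff: "(c - a) * hyp_coeff (a - 1) c k + (2 * a - c) * hyp_coeff a c k
      + (if k = 0 then 0 else hyp_coeff a c (k - 1)) - a * hyp_coeff (a + 1) c k = 0" for k
  proof (cases k)
    case 0
    then show ?thesis by (simp add: hyp_coeff_def)
  next
    case (Suc j)
    let ?P = "pochhammer a j"
    have c0: "c + real j \<noteq> 0" using nz[of "Suc j"] by (auto simp: pochhammer_Suc)
    have "a * pochhammer (a + 1) (Suc j) = ?P * (a + real j) * (a + real j + 1)"
      by (simp only: pochhammer_plus_1) (simp add: pochhammer_Suc algebra_simps)
    moreover have "hyp_coeff a c j = ?P * ((c + real j) * (real j + 1)) / (pochhammer c (Suc j) * fact (Suc j))"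
      using nz[of j] c0 by (simp add: hyp_coeff_def pochhammer_Suc divide_simps)
    ultimately have "(c - a) * hyp_coeff (a - 1) c k + (2 * a - c) * hyp_coeff a c k
      + (if k = 0 then 0 else hyp_coeff a c (k - 1)) - a * hyp_coeff (a + 1) c k
      = ((c - a) * ((a - 1) * ?P) + (2 * a - c) * (?P * (a + real j))
        + ?P * ((c + real j) * (real j + 1)) - ?P * (a + real j) * (a + real j + 1))
        / (pochhammer c (Suc j) * fact (Suc j))"
      unfolding Suc hyp_coeff_def[of _ _ "Suc j"] pochhammer_minus_1
      by (simp add: add_divide_distrib diff_divide_distrib pochhammer_Suc)
    also have "(c - a) * ((a - 1) * ?P) + (2 * a - c) * (?P * (a + real j))
        + ?P * ((c + real j) * (real j + 1)) - ?P * (a + real j) * (a + real j + 1) = 0"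
      by algebra
    finally show ?thesis by simp
  qed
  have "(\<lambda>k. (c - a) * (hyp_coeff (a - 1) c k * x ^ k) + (2 * a - c) * (hyp_coeff a c k * x ^ k)
      + (if k = 0 then 0 else hyp_coeff a c (k - 1)) * x ^ k - a * (hyp_coeff (a + 1) c k * x ^ k))
    sums ((c - a) * confluent_hyp (a - 1) c x + (2 * a - c) * confluent_hyp a c x
      + x * confluent_hyp a c x - a * confluent_hyp (a + 1) c x)"
    by (intro sums_add sums_diff sums_mult confluent_hyp_sums mult_confluent_hyp_sums)
  also have "(\<lambda>k. (c - a) * (hyp_coeff (a - 1) c k * x ^ k) + (2 * a - c) * (hyp_coeff a c k * x ^ k)
      + (if k = 0 then 0 else hyp_coeff a c (k - 1)) * x ^ k - a * (hyp_coeff (a + 1) c k * x ^ k))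
    = (\<lambda>k. ((c - a) * hyp_coeff (a - 1) c k + (2 * a - c) * hyp_coeff a c k
      + (if k = 0 then 0 else hyp_coeff a c (k - 1)) - a * hyp_coeff (a + 1) c k) * x ^ k)"
    by (simp add: algebra_simps)
  also have "\<dots> = (\<lambda>k. 0)"
    by (simp only: coeff mult_zero_left)
  finally have "(c - a) * confluent_hyp (a - 1) c x + (2 * a - c) * confluent_hyp a c x
      + x * confluent_hyp a c x - a * confluent_hyp (a + 1) c x = 0"
    using sums_unique2 sums_zero by blast
  then show ?thesis by (simp add: algebra_simps)
qed

lemma diffs_hyp_coeff:
  "diffs (hyp_coeff a c) k = a / c * hyp_coeff (a + 1) (c + 1) k"
proof -
  have "real (Suc k) * (p / (q * (real (Suc k) * r))) = p / (q * r)" for p q r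
    by (simp del: of_nat_Suc)
  then show ?thesis
    by (simp add: diffs_def hyp_coeff_def pochhammer_rec mult.assoc del: of_nat_Suc)
qed

lemma has_real_derivative_confluent_hyp:
  "(confluent_hyp a c has_real_derivative a / c * confluent_hyp (a + 1) (c + 1) x) (at x)"
proof -
  have "(confluent_hyp a c has_real_derivative (\<Sum>k. diffs (hyp_coeff a c) k * x ^ k)) (at x)"
    unfolding confluent_hyp_altdef[abs_def]
    by (rule termdiffs_strong_converges_everywhere[OF summable_hyp_coeff])
  moreover have "(\<Sum>k. diffs (hyp_coeff a c) k * x ^ k) = a / c * confluent_hyp (a + 1) (c + 1) x"
    using sums_unique[OF sums_mult[OF confluent_hyp_sums[of "a + 1" "c + 1" x], of "a / c"]]
    by (simp add: diffs_hyp_coeff mult_ac)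
  ultimately show ?thesis by simp
qed

text \<open>The left side is \<open>x\<close> times the derivative of
  \<open>confluent_hyp a c\<close>, an operator that multiplies the coefficient of x^k by k. Since
  \<open>a * pochhammer (a + 1) k\<close> equals (a + k) times \<open>pochhammer a k\<close>, this
  factor amounts to a shift of \<open>a\<close> alone.\<close>

lemma confluent_hyp_raise:
  assumes "c \<notin> \<int>\<^sub>\<le>\<^sub>0"
  shows "x * (a / c * confluent_hyp (a + 1) (c + 1) x) = a * (confluent_hyp (a + 1) c x - confluent_hyp a c x)"
proof -
  have "(\<lambda>k. a * (hyp_coeff (a + 1) c k * x ^ k - hyp_coeff a c k * x ^ k))
      sums (a * (confluent_hyp (a + 1) c x - confluent_hyp a c x))"
    by (intro sums_mult sums_diff confluent_hyp_sums)
  moreover have "a * (hyp_coeff (a + 1) c k * x ^ k - hyp_coeff a c k * x ^ k)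
     = a / c * ((if k = 0 then 0 else hyp_coeff (a + 1) (c + 1) (k - 1)) * x ^ k)" for k
  proof (cases k)
    case 0
    then show ?thesis by (simp add: hyp_coeff_def)
  next
    case (Suc j)
    have "a * (hyp_coeff (a + 1) c k - hyp_coeff a c k) = (pochhammer a (Suc k) - a * pochhammer a k) / (pochhammer c k * fact k)"
      by (simp only: hyp_coeff_def right_diff_distrib diff_divide_distrib times_divide_eq_right pochhammer_plus_1)
    also have "\<dots> = real k * (a * pochhammer (a + 1) j) / (pochhammer c k * fact k)"
      by (simp only: pochhammer_plus_1 Suc[symmetric]) (simp add: pochhammer_Suc algebra_simps)
    also have "\<dots> = a / c * hyp_coeff (a + 1) (c + 1) j"
      by (simp add: Suc hyp_coeff_def pochhammer_rec)
    finally show ?thesis using Suc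
      by (simp only: right_diff_distrib[symmetric] left_diff_distrib[symmetric] mult.assoc[symmetric]) simp
  qed
  ultimately show ?thesis
    using sums_unique2[OF sums_mult[OF mult_confluent_hyp_sums, of "a / c" "a + 1" "c + 1" x]]
    by (metis (no_types, lifting) ext mult.left_commute)
qed

lemma confluent_hyp_same:
  assumes "c \<notin> \<int>\<^sub>\<le>\<^sub>0"
  shows "confluent_hyp c c x = exp x"
proof -
  have "pochhammer c k \<noteq> 0" for k
    using assms by (auto simp: pochhammer_eq_0_iff)
  then show ?thesis
    by (simp add: confluent_hyp_def exp_def field_simps)
qed

text \<open>The series stops at degree n because \<open>pochhammer (- real n) k\<close> vanishes for
  k > n. With this form, recurrence and derivative of the Laguerre polynomials become identities for
  \<Phi>.\<close>

lemma laguerre_confluent_hyp: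
  assumes "\<alpha> > -1"
  shows "laguerre n \<alpha> x = pochhammer (\<alpha> + 1) n / fact n * confluent_hyp (- real n) (\<alpha> + 1) x"
proof -
  have nz: "pochhammer (\<alpha> + 1) k > 0" for k
    using assms by (intro pochhammer_pos) auto
  have "hyp_coeff (- real n) (\<alpha> + 1) k * x ^ k = 0" if "k \<notin> {0..n}" for k
    using that pochhammer_of_nat_eq_0_lemma[of n k, where ?'a = real] by (auto simp: hyp_coeff_def)
  then have "confluent_hyp (- real n) (\<alpha> + 1) x = (\<Sum>k=0..n. hyp_coeff (- real n) (\<alpha> + 1) k * x ^ k)"
    unfolding confluent_hyp_altdef by (intro suminf_finite) auto
  moreover have "((real n + \<alpha>) gchoose (n - k)) * ((- 1) ^ k * x ^ k) / fact k
     = pochhammer (\<alpha> + 1) n / fact n * (hyp_coeff (- real n) (\<alpha> + 1) k * x ^ k)"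
    if "k \<in> {0..n}" for k
  proof -
    have k: "k \<le> n" using that by simp
    have g: "(real n + \<alpha>) gchoose (n - k) = pochhammer (\<alpha> + 1 + real k) (n - k) / fact (n - k)"
      using k by (simp add: gbinomial_pochhammer' of_nat_diff algebra_simps)
    have p: "pochhammer (\<alpha> + 1) n = pochhammer (\<alpha> + 1) k * pochhammer (\<alpha> + 1 + real k) (n - k)"
      using pochhammer_product[OF k] by blast
    have "real (n choose k) = (-1) ^ k * pochhammer (- real n) k / fact k"
      by (simp add: binomial_gbinomial gbinomial_pochhammer)
    then have m: "pochhammer (- real n) k = (-1) ^ k * (fact n / fact (n - k))"
      using k by (auto simp: binomial_fact field_simps simp flip: power_mult_distrib)
    show ?thesis
      unfolding hyp_coeff_def g p m using nz[of k] by (simp add: field_simps)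
  qed
  ultimately show ?thesis
    by (simp add: laguerre_def sum_distrib_left)
qed

lemma laguerre_0 [simp]: "laguerre 0 \<alpha> x = 1"
  by (simp add: laguerre_def)

lemma laguerre_1: "laguerre (Suc 0) \<alpha> x = 1 + \<alpha> - x"
  by (simp add: laguerre_def)

lemma pochhammer_div_fact_Suc:
  "real (Suc k) * (pochhammer c (Suc k) / fact (Suc k)) = (c + real k) * (pochhammer c k / fact k)"
  by (simp add: pochhammer_Suc del: of_nat_Suc)

lemma laguerre_recurrence:
  assumes "\<alpha> > -1"
  shows "real (n + 2) * laguerre (n + 2) \<alpha> x =
    (real (2 * n + 3) + \<alpha> - x) * laguerre (n + 1) \<alpha> x - (real (n + 1) + \<alpha>) * laguerre n \<alpha> x"
proof -
  let ?c = "\<alpha> + 1"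
  define F where "F k = confluent_hyp (- real k) (\<alpha> + 1) x" for k
  \<comment> \<open>The normalising factor of degree n + 1. The neighbouring degrees are expressed
    through the same factor, so that the contiguous relation can simply be multiplied by it.\<close>
  define B where "B = pochhammer ?c (n + 1) / fact (n + 1)"
  have c: "?c \<notin> \<int>\<^sub>\<le>\<^sub>0" using assms by (auto elim!: nonpos_Ints_cases)
  have B: "real (n + 2) * laguerre (n + 2) \<alpha> x = B * (\<alpha> + real n + 2) * F (n + 2)"
    "laguerre (n + 1) \<alpha> x = B * F (n + 1)"
    "(real (n + 1) + \<alpha>) * laguerre n \<alpha> x = B * real (n + 1) * F n"
  proof -
    show "real (n + 2) * laguerre (n + 2) \<alpha> x = B * (\<alpha> + real n + 2) * F (n + 2)"
      using arg_cong[OF pochhammer_div_fact_Suc[of "n + 1" ?c], of "\<lambda>u. u * F (n + 2)"]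
      unfolding laguerre_confluent_hyp[OF assms] B_def F_def[symmetric] by (simp add: algebra_simps)
    show "(real (n + 1) + \<alpha>) * laguerre n \<alpha> x = B * real (n + 1) * F n"
      using arg_cong[OF pochhammer_div_fact_Suc[of n ?c], of "\<lambda>u. u * F n"]
      unfolding laguerre_confluent_hyp[OF assms] B_def F_def[symmetric] by (simp add: algebra_simps)
    show "laguerre (n + 1) \<alpha> x = B * F (n + 1)"
      unfolding laguerre_confluent_hyp[OF assms] B_def F_def[symmetric] ..
  qed
  have "(?c + real (n + 1)) * F (n + 2) + (- 2 * real (n + 1) - ?c + x) * F (n + 1)
      = - real (n + 1) * F n"
    using confluent_hyp_contiguous[OF c, of "- real (n + 1)" x] by (simp add: F_def algebra_simps)
  then have "(?c + real (n + 1)) * F (n + 2) = - real (n + 1) * F n - (- 2 * real (n + 1) - ?c + x) * F (n + 1)"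
    by linarith
  then have "B * ((?c + real (n + 1)) * F (n + 2)) = B * (- real (n + 1) * F n - (- 2 * real (n + 1) - ?c + x) * F (n + 1))"
    by (rule arg_cong)
  then show ?thesis unfolding B by (simp add: algebra_simps)
qed

text \<open>At a zero the first term drops out, and the reciprocal of the derivative is the
  quadrature coefficient \<open>quad_weight\<close>.\<close>

lemma has_real_derivative_laguerre:
  assumes "\<alpha> > -1" "n \<ge> 1" "x > 0"
  shows "(laguerre n \<alpha> has_real_derivative
    (real n * laguerre n \<alpha> x - (real n + \<alpha>) * laguerre (n - 1) \<alpha> x) / x) (at x)"
proof -
  let ?B = "pochhammer (\<alpha> + 1) n / fact n"
  define D where "D = ?B * (- real n / (\<alpha> + 1) * confluent_hyp (- real n + 1) (\<alpha> + 1 + 1) x)"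
  have c: "\<alpha> + 1 \<notin> \<int>\<^sub>\<le>\<^sub>0" using assms by (auto elim!: nonpos_Ints_cases)
  have "laguerre n \<alpha> = (\<lambda>x. ?B * confluent_hyp (- real n) (\<alpha> + 1) x)"
    by (rule ext) (rule laguerre_confluent_hyp[OF assms(1)])
  then have d: "(laguerre n \<alpha> has_real_derivative D) (at x)"
    unfolding D_def by (simp only:) (intro DERIV_cmult has_real_derivative_confluent_hyp)
  have "x * D = ?B * (- real n * (confluent_hyp (- real n + 1) (\<alpha> + 1) x - confluent_hyp (- real n) (\<alpha> + 1) x))"
    unfolding D_def confluent_hyp_raise[OF c, symmetric] by (simp add: algebra_simps)
  moreover have "?B * real n * confluent_hyp (- real n + 1) (\<alpha> + 1) x = (real n + \<alpha>) * laguerre (n - 1) \<alpha> x"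
  proof -
    obtain j where j: "n = Suc j" using assms(2) by (cases n) auto
    show ?thesis
      using arg_cong[OF pochhammer_div_fact_Suc[of j "\<alpha> + 1"], of "\<lambda>u. u * confluent_hyp (- real j) (\<alpha> + 1) x"]
      unfolding laguerre_confluent_hyp[OF assms(1)] j by (simp add: algebra_simps)
  qed
  ultimately have "x * D = real n * laguerre n \<alpha> x - (real n + \<alpha>) * laguerre (n - 1) \<alpha> x"
    by (simp add: laguerre_confluent_hyp[OF assms(1), of n] algebra_simps)
  then have "D = (real n * laguerre n \<alpha> x - (real n + \<alpha>) * laguerre (n - 1) \<alpha> x) / x"
    using assms(3) by (simp add: field_simps)
  with d show ?thesis by simp
qed

text \<open>For x \<le> 0 the alternating signs are absorbed into powers of -x, and all generalized
  binomial coefficients are positive. Hence every real zero is positive.\<close>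

lemma laguerre_pos_nonpos:
  assumes "\<alpha> > -1" "x \<le> 0"
  shows "laguerre n \<alpha> x > 0"
proof -
  have g: "((real n + \<alpha>) gchoose (n - k)) > 0" if "k \<le> n" for k
    unfolding gbinomial_pochhammer' using assms(1) that
    by (auto intro!: divide_pos_pos pochhammer_pos simp: of_nat_diff)
  have "laguerre n \<alpha> x = (\<Sum>k\<in>{0..n}. ((real n + \<alpha>) gchoose (n - k)) * (- x) ^ k / fact k)"
    by (simp add: laguerre_def power_mult_distrib[symmetric])
  also have "\<dots> > 0"
  proof (rule sum_pos2[of _ 0])
    show "0 \<le> ((real n + \<alpha>) gchoose (n - k)) * (- x) ^ k / fact k" if "k \<in> {0..n}" for k
      using g[of k] that assms(2) by (auto intro!: divide_nonneg_nonneg mult_nonneg_nonneg)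
  qed (use g[of 0] in auto)
  finally show ?thesis .
qed

section \<open>Recurrence and derivative of \<open>laguerre_Q\<close>\<close>

lemma one_minus_notin_nonpos_Ints:
  assumes "(\<alpha>::real) \<notin> \<nat>"
  shows "1 - \<alpha> \<notin> \<int>\<^sub>\<le>\<^sub>0"
proof
  assume "1 - \<alpha> \<in> \<int>\<^sub>\<le>\<^sub>0"
  then obtain k where "1 - \<alpha> = - real k" by (auto elim: nonpos_Ints_cases')
  then have "\<alpha> = real (Suc k)" by simp
  with assms show False by (metis of_nat_in_Nats)
qed

text \<open>The contiguous relation at a = -\<alpha> has \<Phi>(1 - \<alpha>, 1 - \<alpha>; x) = e^x
  in the place of a predecessor. Multiplied by e^(-x) this becomes the constant
  \<open>Gamma (\<alpha> + 1) / pi\<close>, so the first step of the recurrence is inhomogeneous; on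
  the integral side the same constant is the total mass of the weight.\<close>

lemma laguerre_Q_1:
  assumes "\<alpha> > -1" "\<alpha> \<notin> \<nat>"
  shows "laguerre_Q (Suc 0) \<alpha> x = (1 + \<alpha> - x) * laguerre_Q 0 \<alpha> x - Gamma (\<alpha> + 1) / pi"
proof -
  have "\<alpha> \<notin> \<int>\<^sub>\<le>\<^sub>0" using assms(1,2)
    by (auto elim!: nonpos_Ints_cases')
  then have G: "Gamma (\<alpha> + 1) = \<alpha> * Gamma \<alpha>" by (rule Gamma_plus1)
  note c = one_minus_notin_nonpos_Ints[OF assms(2)]
  have "confluent_hyp (-1 - \<alpha>) (1 - \<alpha>) x = (1 + \<alpha> - x) * confluent_hyp (- \<alpha>) (1 - \<alpha>) x - \<alpha> * exp x"
    using confluent_hyp_contiguous[OF c, of "- \<alpha>" x] confluent_hyp_same[OF c, of x]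
      minus_diff_commute[of \<alpha> 1] by (simp add: algebra_simps)
  then have F: "confluent_hyp (- real (Suc 0) - \<alpha>) (1 - \<alpha>) x = (1 + \<alpha> - x) * confluent_hyp (- real 0 - \<alpha>) (1 - \<alpha>) x - \<alpha> * exp x"
    by simp
  define u v where "u = Gamma \<alpha> / pi * exp (- x)" and "v = cot (pi * \<alpha>) * x powr \<alpha> * exp (- x)"
  have "Gamma (\<alpha> + 1) / pi = \<alpha> * (u * exp x)"
    by (simp add: u_def G mult_exp_exp)
  then show ?thesis
    unfolding laguerre_Q_def laguerre_0 laguerre_1 F u_def[symmetric] v_def[symmetric]
    by (simp add: algebra_simps)
qed

text \<open>The factors \<open>u\<close> and \<open>v\<close> do not depend on the degree, and the
  \<Phi> part and the Laguerre part obey the same recurrence.\<close>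

lemma laguerre_Q_recurrence:
  assumes "\<alpha> > -1" "\<alpha> \<notin> \<nat>"
  shows "real (n + 2) * laguerre_Q (n + 2) \<alpha> x =
    (real (2 * n + 3) + \<alpha> - x) * laguerre_Q (n + 1) \<alpha> x - (real (n + 1) + \<alpha>) * laguerre_Q n \<alpha> x"
proof -
  define F where "F k = confluent_hyp (- real k - \<alpha>) (1 - \<alpha>) x" for k
  note c = one_minus_notin_nonpos_Ints[OF assms(2)]
  have F: "real (n + 2) * F (n + 2)
      = (real (2 * n + 3) + \<alpha> - x) * F (n + 1) - (real (n + 1) + \<alpha>) * F n"
  proof -
    have e: "- real (n + 1) - \<alpha> - 1 = - real (n + 2) - \<alpha>" "- real (n + 1) - \<alpha> + 1 = - real n - \<alpha>"
      by simp_all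
    show ?thesis
      using confluent_hyp_contiguous[OF c, of "- real (n + 1) - \<alpha>" x]
      unfolding e F_def[symmetric] by (simp add: algebra_simps)
  qed
  define u v where "u = Gamma \<alpha> / pi * exp (- x)" and "v = cot (pi * \<alpha>) * x powr \<alpha> * exp (- x)"
  have Q: "laguerre_Q k \<alpha> x = u * F k - v * laguerre k \<alpha> x" for k
    by (simp add: laguerre_Q_def u_def v_def F_def)
  have "real (n + 2) * laguerre_Q (n + 2) \<alpha> x =
      u * (real (n + 2) * F (n + 2)) - v * (real (n + 2) * laguerre (n + 2) \<alpha> x)"
    unfolding Q by (simp add: algebra_simps)
  also have "\<dots> = (real (2 * n + 3) + \<alpha> - x) * laguerre_Q (n + 1) \<alpha> x - (real (n + 1) + \<alpha>) * laguerre_Q n \<alpha> x"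
    unfolding F laguerre_recurrence[OF assms(1)] Q by algebra
  finally show ?thesis .
qed

lemma has_real_derivative_laguerre_Q:
  assumes "\<alpha> > -1" "n \<ge> 1" "x > 0" "laguerre n \<alpha> x = 0"
  shows "(laguerre_Q n \<alpha> has_real_derivative
        (1 / pi * exp (- x) * Gamma \<alpha> *
           ((real n + \<alpha>) / (\<alpha> - 1) * confluent_hyp (- real n - \<alpha> + 1) (2 - \<alpha>) x
            - confluent_hyp (- real n - \<alpha>) (1 - \<alpha>) x)
         + cot (pi * \<alpha>) * x powr (\<alpha> - 1) * exp (- x) * (real n + \<alpha>)
             * laguerre (n - 1) \<alpha> x)) (at x)"
proof -
  have fr: "(- real n - \<alpha>) / (1 - \<alpha>) = (real n + \<alpha>) / (\<alpha> - 1)"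
    using minus_divide_divide[of "real n + \<alpha>" "\<alpha> - 1"] by simp
  have pw: "x powr \<alpha> / x = x powr (\<alpha> - 1)"
    using assms(3) by (simp add: powr_diff)
  have d1: "(confluent_hyp (- real n - \<alpha>) (1 - \<alpha>) has_real_derivative
      (real n + \<alpha>) / (\<alpha> - 1) * confluent_hyp (- real n - \<alpha> + 1) (2 - \<alpha>) x) (at x)"
    using has_real_derivative_confluent_hyp[of "- real n - \<alpha>" "1 - \<alpha>" x] unfolding fr by simp
  have d2: "(laguerre n \<alpha> has_real_derivative - ((real n + \<alpha>) * laguerre (n - 1) \<alpha> x) / x) (at x)"
    using has_real_derivative_laguerre[OF assms(1-3)] assms(4) by simp
  have e: "((\<lambda>x. Gamma \<alpha> / pi * exp (- x)) has_real_derivative - (Gamma \<alpha> / pi * exp (- x))) (at x)"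
    by (auto intro!: derivative_eq_intros)
  \<comment> \<open>The derivative \<open>W\<close> of the weight factor stays implicit: in the
    product rule it is multiplied by \<open>laguerre n \<alpha> x\<close>, which is 0.\<close>
  have "\<exists>W. ((\<lambda>x. cot (pi * \<alpha>) * (x powr \<alpha> * exp (- x))) has_real_derivative W) (at x)"
    using assms(3) by (intro exI) (rule derivative_eq_intros refl | simp)+
  then obtain W where w: "((\<lambda>x. cot (pi * \<alpha>) * (x powr \<alpha> * exp (- x))) has_real_derivative W) (at x)"
    by blast
  have "laguerre_Q n \<alpha> = (\<lambda>x. Gamma \<alpha> / pi * exp (- x) * confluent_hyp (- real n - \<alpha>) (1 - \<alpha>) x
     - cot (pi * \<alpha>) * (x powr \<alpha> * exp (- x)) * laguerre n \<alpha> x)"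
    by (simp add: laguerre_Q_def fun_eq_iff)
  moreover define E P F K L where "E = exp (- x)" and "P = x powr \<alpha>"
    and "F = confluent_hyp (- real n - \<alpha>) (1 - \<alpha>) x"
    and "K = (real n + \<alpha>) / (\<alpha> - 1) * confluent_hyp (- real n - \<alpha> + 1) (2 - \<alpha>) x"
    and "L = (real n + \<alpha>) * laguerre (n - 1) \<alpha> x"
  moreover have "1 / pi * E * Gamma \<alpha> * (K - F) + cot (pi * \<alpha>) * (P / x) * E * L
      = - (Gamma \<alpha> / pi * E) * F + K * (Gamma \<alpha> / pi * E)
        - (W * 0 + - L / x * (cot (pi * \<alpha>) * (P * E)))"
    by (simp add: algebra_simps diff_divide_distrib)
  ultimately show ?thesis
    using DERIV_diff[OF DERIV_mult[OF e d1] DERIV_mult[OF w d2]]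
    by (simp only: assms(4) pw[symmetric] mult.assoc)
qed

section \<open>The principal value of the weight\<close>

lemma set_integrable_Gamma:
  fixes s :: real
  assumes "s > -1"
  shows "set_integrable lborel {0..} (\<lambda>t. t powr s * exp (- t))"
    and "(LINT t:{0..}|lborel. t powr s * exp (- t)) = Gamma (s + 1)"
proof -
  have "((\<lambda>t. t powr s * exp (- t)) has_integral Gamma (s + 1)) {0..}"
    using Gamma_integral_real[of "s + 1"] assms by (simp add: exp_minus field_simps)
  then show "set_integrable lborel {0..} (\<lambda>t. t powr s * exp (- t))"
    "(LINT t:{0..}|lborel. t powr s * exp (- t)) = Gamma (s + 1)"
    by (rule set_integrable_has_integral_nonneg[rotated 3]; simp)+
qed

text \<open>Substitution of \<open>r * t\<close> in the Gamma integral. Stated as a nonnegative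
  integral, it serves both as inner integral of the exchange and as proof of integrability.\<close>

lemma nn_integral_Gamma_scaled:
  fixes r s :: real
  assumes "s > -1" "r > 0"
  shows "(\<integral>\<^sup>+t. ennreal (indicator {0..} t * (t powr s * exp (- (r * t)))) \<partial>lborel)
    = ennreal (Gamma (s + 1) * r powr (- s - 1))"
proof -
  let ?F = "\<lambda>t. indicator {0..} t * t powr s / exp t :: real"
  have G: "Gamma (s + 1) > 0" using assms by (intro Gamma_real_pos) simp
  have "ennreal (Gamma (s + 1)) = (\<integral>\<^sup>+t. ennreal (?F t) \<partial>lborel)"
    using Gamma_conv_nn_integral_real[of "s + 1"] assms by simp
  also have "\<dots> = ennreal r * (\<integral>\<^sup>+t. ennreal (?F (r * t)) \<partial>lborel)"
    using assms nn_integral_real_affine[of "\<lambda>t. ennreal (?F t)" r 0] by simp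
  finally have 1: "ennreal (Gamma (s + 1)) = ennreal r * (\<integral>\<^sup>+t. ennreal (?F (r * t)) \<partial>lborel)" .
  have "(\<integral>\<^sup>+t. ennreal (indicator {0..} t * (t powr s * exp (- (r * t)))) \<partial>lborel)
      = (\<integral>\<^sup>+t. ennreal (r powr (- s - 1)) * (ennreal r * ennreal (?F (r * t))) \<partial>lborel)"
  proof (rule nn_integral_cong)
    fix t :: real
    have "r powr (- s - 1) * r = r powr (- s)"
      using assms by (simp add: powr_diff powr_minus field_simps)
    then have "r powr (- s - 1) * (r * ?F (r * t)) = r powr (- s) * ?F (r * t)"
      by (metis mult.assoc)
    also have "\<dots> = indicator {0..} t * (t powr s * exp (- (r * t)))"
      using assms by (auto simp: indicator_def powr_mult powr_minus exp_minus field_simps zero_le_mult_iff)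
    finally show "ennreal (indicator {0..} t * (t powr s * exp (- (r * t))))
        = ennreal (r powr (- s - 1)) * (ennreal r * ennreal (?F (r * t)))"
      using assms by (simp add: ennreal_mult[symmetric])
  qed
  also have "\<dots> = ennreal (r powr (- s - 1)) * ennreal (Gamma (s + 1))"
    unfolding 1 using assms by (simp add: nn_integral_cmult)
  finally show ?thesis
    using G by (simp add: ennreal_mult[symmetric] mult.commute)
qed

lemma set_integrable_Gamma_scaled:
  fixes r s :: real
  assumes "s > -1" "r > 0"
  shows "set_integrable lborel {0..} (\<lambda>t. t powr s * exp (- (r * t)))"
  unfolding set_integrable_def real_scaleR_def
  by (rule integrableI_nonneg) (auto simp: nn_integral_Gamma_scaled[OF assms])

text \<open>The substitution rule is about absolute integrability with respect to the completed
  measure; for Borel sets and functions the integrals over \<open>lebesgue\<close> and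
  \<open>lborel\<close> coincide.\<close>

lemma set_lborel_change_of_variables:
  fixes f g g' :: "real \<Rightarrow> real"
  assumes [measurable]: "S \<in> sets borel" "g ` S \<in> sets borel"
    and meas [measurable]: "f \<in> borel_measurable borel" "(\<lambda>t. \<bar>g' t\<bar> * f (g t)) \<in> borel_measurable borel"
    and der: "\<And>t. t \<in> S \<Longrightarrow> (g has_field_derivative g' t) (at t within S)"
    and inj: "inj_on g S"
    and int: "set_integrable lborel (g ` S) f"
  shows "set_integrable lborel S (\<lambda>t. \<bar>g' t\<bar> * f (g t))"
    and "(LINT t:S|lborel. \<bar>g' t\<bar> * f (g t)) = (LINT t:g ` S|lborel. f t)"
proof -
  have leb: "set_integrable lebesgue A h \<longleftrightarrow> set_integrable lborel A h"
    "set_lebesgue_integral lebesgue A h = set_lebesgue_integral lborel A h"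
    if [measurable]: "A \<in> sets borel" "h \<in> borel_measurable borel" for A and h :: "real \<Rightarrow> real"
  proof -
    have "(\<lambda>x. indicat_real A x *\<^sub>R h x) \<in> borel_measurable lborel" by simp
    then show "set_integrable lebesgue A h \<longleftrightarrow> set_integrable lborel A h"
      "set_lebesgue_integral lebesgue A h = set_lebesgue_integral lborel A h"
      unfolding set_integrable_def set_lebesgue_integral_def
      by (rule integrable_completion integral_completion)+
  qed
  have S: "S \<in> sets lebesgue" using assms(1) by auto
  have 1: "f absolutely_integrable_on g ` S" using int leb(1)[of "g ` S" f] by simp
  have 2: "(\<lambda>t. \<bar>g' t\<bar> * f (g t)) absolutely_integrable_on S"
    "integral S (\<lambda>t. \<bar>g' t\<bar> * f (g t)) = integral (g ` S) f"
    using has_absolute_integral_change_of_variables_1'[OF S der inj, of f "integral (g ` S) f"] 1 by auto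
  show "set_integrable lborel S (\<lambda>t. \<bar>g' t\<bar> * f (g t))"
    using 2(1) leb(1)[of S "\<lambda>t. \<bar>g' t\<bar> * f (g t)"] by simp
  show "(LINT t:S|lborel. \<bar>g' t\<bar> * f (g t)) = (LINT t:g ` S|lborel. f t)"
  proof -
    have "(LINT t:S|lborel. \<bar>g' t\<bar> * f (g t)) = (LINT t:S|lebesgue. \<bar>g' t\<bar> * f (g t))"
      by (rule leb(2)[symmetric]) simp_all
    also have "\<dots> = integral (g ` S) f"
      using set_lebesgue_integral_eq_integral(2)[OF 2(1)] 2(2) by simp
    also have "\<dots> = (LINT t:g ` S|lebesgue. f t)"
      using set_lebesgue_integral_eq_integral(2)[OF 1] by simp
    also have "\<dots> = (LINT t:g ` S|lborel. f t)"
      by (rule leb(2)) simp_all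
    finally show ?thesis .
  qed
qed

section \<open>The cotangent and the kernel \<open>t powr \<alpha> / (t - x)\<close>\<close>

text \<open>Logarithmic derivative of the reflection formula. The reciprocal Gamma function keeps
  everything a product, and the real formula is read off from the complex one.\<close>

lemma Digamma_reflection_real:
  assumes "0 < z" "z < (1::real)"
  shows "Digamma (1 - z) - Digamma z = pi * cot (pi * z)"
proof -
  have eq: "rGamma t * rGamma (1 - t) = sin (pi * t) / pi" for t :: real
  proof -
    have "complex_of_real (rGamma t * rGamma (1 - t)) = rGamma (of_real t) * rGamma (1 - of_real t)"
      using rGamma_complex_of_real[of t] rGamma_complex_of_real[of "1 - t"] by simp
    also have "\<dots> = sin (of_real pi * of_real t) / of_real pi"
      by (rule rGamma_reflection_complex)
    also have "\<dots> = complex_of_real (sin (pi * t) / pi)"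
      using sin_of_real[of "pi * t", where ?'a = complex] by simp
    finally have "complex_of_real (rGamma t * rGamma (1 - t)) = complex_of_real (sin (pi * t) / pi)" .
    then show ?thesis by (simp only: of_real_eq_iff)
  qed
  have nz: "z \<notin> \<int>\<^sub>\<le>\<^sub>0" "1 - z \<notin> \<int>\<^sub>\<le>\<^sub>0"
    using assms by (auto elim!: nonpos_Ints_cases')
  have s: "sin (pi * z) > 0"
    using assms by (intro sin_gt_zero) auto
  have d1: "(rGamma has_field_derivative - rGamma z * Digamma z) (at z)"
    using nz(1) by (rule has_field_derivative_rGamma_no_nonpos_int)
  have d2: "(rGamma has_field_derivative - rGamma (1 - z) * Digamma (1 - z)) (at (1 - z))"
    using nz(2) by (rule has_field_derivative_rGamma_no_nonpos_int)
  have d2': "((\<lambda>t. rGamma (1 - t)) has_field_derivative - rGamma (1 - z) * Digamma (1 - z) * (0 - 1)) (at z)"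
    by (rule DERIV_chain2[where f = rGamma and g = "\<lambda>t. 1 - t", OF d2]) (auto intro!: derivative_eq_intros)
  have "((\<lambda>t. rGamma t * rGamma (1 - t)) has_field_derivative
      (- rGamma z * Digamma z) * rGamma (1 - z) + (- rGamma (1 - z) * Digamma (1 - z) * (0 - 1)) * rGamma z) (at z)"
    by (rule DERIV_mult[OF d1 d2'])
  moreover have "((\<lambda>t. rGamma t * rGamma (1 - t)) has_field_derivative cos (pi * z)) (at z)"
    unfolding eq by (auto intro!: derivative_eq_intros)
  ultimately have "(- rGamma z * Digamma z) * rGamma (1 - z) + (- rGamma (1 - z) * Digamma (1 - z) * (0 - 1)) * rGamma z = cos (pi * z)"
    by (rule DERIV_unique)
  then have "(rGamma z * rGamma (1 - z)) * (Digamma (1 - z) - Digamma z) = cos (pi * z)"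
    by (simp add: algebra_simps)
  then show ?thesis
    using s unfolding eq by (simp add: cot_def field_simps)
qed

text \<open>In the difference of the limit formulas for \<open>Digamma\<close> at 1 - z and z the
  logarithms cancel. What is left are the partial sums, already paired as needed for
  convergence.\<close>

lemma cot_partial_fractions_sums:
  assumes "0 < z" "z < (1::real)"
  shows "(\<lambda>k. 1 / (real k + z) - 1 / (real k + 1 - z)) sums (pi * cot (pi * z))"
proof -
  have "(\<lambda>m. (ln (real m) - (\<Sum>n<m. inverse ((1 - z) + real n))) - (ln (real m) - (\<Sum>n<m. inverse (z + real n))))
      \<longlonglongrightarrow> Digamma (1 - z) - Digamma z"
    using Digamma_LIMSEQ[of z] Digamma_LIMSEQ[of "1 - z"] assms by (intro tendsto_diff) auto
  then show ?thesis
    unfolding sums_def Digamma_reflection_real[OF assms]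
    by (simp add: sum_subtractf divide_inverse algebra_simps)
qed

lemma set_integrable_powr_div_one_minus:
  fixes b r :: real
  assumes "b > -1" "0 \<le> r" "r < 1"
  shows "set_integrable lborel {0..r} (\<lambda>v. v powr b / (1 - v))"
proof (rule set_integrable_bound)
  have "set_integrable lborel {0..r} (\<lambda>v. v powr b)"
    by (rule set_integrable_has_integral_nonneg(1)[OF _ _ _ has_integral_powr_from_0]) (use assms in auto)
  then show "set_integrable lborel {0..r} (\<lambda>v. 1 / (1 - r) * v powr b)"
    by (rule set_integrable_mult_right)
  show "set_borel_measurable lborel {0..r} (\<lambda>v. v powr b / (1 - v))"
    unfolding set_borel_measurable_def by simp
  show "AE v in lborel. v \<in> {0..r} \<longrightarrow> norm (v powr b / (1 - v)) \<le> norm (1 / (1 - r) * v powr b)"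
    using assms by (intro AE_I2) (auto intro!: divide_left_mono simp: abs_mult)
qed

text \<open>In the geometric expansion of 1 / (1 - v) the k-th term integrates to 1 / (k - \<alpha>)
  - 1 / (k + 1 + \<alpha>), the k-th partial fraction of the cotangent at -\<alpha>. Each power
  alone would give a divergent integral at v = 1; their difference vanishes there.\<close>

lemma integral_powr_kernel_symmetrized:
  assumes "-1 < \<alpha>" "\<alpha> < (0::real)"
  shows "set_integrable lborel {0..1} (\<lambda>v. (v powr (- \<alpha> - 1) - v powr \<alpha>) / (1 - v))"
    and "(LINT v:{0..1}|lborel. (v powr (- \<alpha> - 1) - v powr \<alpha>) / (1 - v)) = - (pi * cot (pi * \<alpha>))"
proof -
  \<comment> \<open>On the unit interval the difference of the two powers has one sign, determined
    by the smaller exponent. After multiplication by \<sigma> all terms are nonnegative, and the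
    summability of the norms is just the convergence of the cotangent series.\<close>
  define \<sigma> :: real where "\<sigma> = (if - \<alpha> - 1 \<le> \<alpha> then 1 else - 1)"
  define f where "f k v = indicat_real {0..1} v * (v ^ k * (v powr (- \<alpha> - 1) - v powr \<alpha>))" for k v
  define a where "a k = 1 / (real k + (- \<alpha>)) - 1 / (real k + 1 - (- \<alpha>))" for k
  have pos: "\<sigma> * f k v \<ge> 0" for k v
  proof (cases "v \<in> {0..1}")
    case True
    then have "\<sigma> * (v powr (- \<alpha> - 1) - v powr \<alpha>) \<ge> 0"
      unfolding \<sigma>_def using powr_mono'[of "- \<alpha> - 1" \<alpha> v] powr_mono'[of \<alpha> "- \<alpha> - 1" v]
      by (auto simp: algebra_simps)
    then have "v ^ k * (\<sigma> * (v powr (- \<alpha> - 1) - v powr \<alpha>)) \<ge> 0"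
      by (rule mult_nonneg_nonneg[rotated]) (use True in simp)
    also have "v ^ k * (\<sigma> * (v powr (- \<alpha> - 1) - v powr \<alpha>)) = \<sigma> * f k v"
      using True by (simp add: f_def)
    finally show ?thesis .
  qed (simp add: f_def)
  have norm_f: "norm (f k v) = \<sigma> * f k v" for k v
    using pos[of k v] by (cases "\<sigma> = 1") (auto simp: \<sigma>_def split: if_splits)
  have pow: "set_integrable lborel {0..1} (\<lambda>v. v ^ k * v powr s)"
    "(LINT v:{0..1}|lborel. v ^ k * v powr s) = 1 / (real k + s + 1)" if "s > -1" for k and s :: real
  proof -
    have "((\<lambda>v. v powr (real k + s)) has_integral 1 / (real k + s + 1)) {0..1}"
      using has_integral_powr_from_0[of "real k + s" 1] that by simp
    then have "((\<lambda>v. v ^ k * v powr s) has_integral 1 / (real k + s + 1)) {0..1}"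
      by (rule has_integral_spike[of "{0}", rotated 2]) (auto simp: powr_add powr_realpow)
    then show "set_integrable lborel {0..1} (\<lambda>v. v ^ k * v powr s)"
      "(LINT v:{0..1}|lborel. v ^ k * v powr s) = 1 / (real k + s + 1)"
      by (rule set_integrable_has_integral_nonneg[rotated 3]; simp)+
  qed
  have int_f: "integrable lborel (f k)" and val_f: "integral\<^sup>L lborel (f k) = a k" for k
  proof -
    have s: "- \<alpha> - 1 > -1" "\<alpha> > -1" using assms by auto
    have "f k = (\<lambda>v. indicat_real {0..1} v *\<^sub>R (v ^ k * v powr (- \<alpha> - 1))
        - indicat_real {0..1} v *\<^sub>R (v ^ k * v powr \<alpha>))"
      by (simp add: f_def algebra_simps fun_eq_iff)
    then show "integrable lborel (f k)" "integral\<^sup>L lborel (f k) = a k"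
      using pow[OF s(1), of k] pow[OF s(2), of k]
      by (simp_all add: set_integrable_def set_lebesgue_integral_def a_def)
  qed
  have a_sums: "a sums (- (pi * cot (pi * \<alpha>)))"
    using cot_partial_fractions_sums[of "- \<alpha>"] assms unfolding a_def by simp
  have norm_sum: "summable (\<lambda>k. \<integral>v. norm (f k v) \<partial>lborel)"
    unfolding norm_f using sums_summable[OF a_sums]
    by (simp add: val_f summable_mult)
  have sums_f: "(\<lambda>k. f k v) sums (indicat_real {0..1} v * ((v powr (- \<alpha> - 1) - v powr \<alpha>) / (1 - v)))"
    if "v \<noteq> 1" for v
  proof (cases "v \<in> {0..1}")
    case True
    then have "(\<lambda>k. v ^ k) sums (1 / (1 - v))"
      using that by (intro geometric_sums) auto
    from sums_mult2[OF this, of "v powr (- \<alpha> - 1) - v powr \<alpha>"] show ?thesis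
      using True by (simp add: f_def)
  qed (simp add: f_def)
  have summ: "AE v in lborel. summable (\<lambda>k. norm (f k v))"
    using AE_lborel_singleton[of "1::real"]
  proof eventually_elim
    case (elim v)
    then show ?case
      unfolding norm_f using sums_f[THEN sums_summable] by (intro summable_mult) auto
  qed
  have ae: "AE v in lborel. (\<Sum>k. f k v) = indicat_real {0..1} v * ((v powr (- \<alpha> - 1) - v powr \<alpha>) / (1 - v))"
    using AE_lborel_singleton[of "1::real"]
    by eventually_elim (use sums_f sums_unique in fastforce)
  have meas: "(\<lambda>v. \<Sum>k. f k v) \<in> borel_measurable lborel"
    unfolding f_def by measurable
  have "integrable lborel (\<lambda>v. \<Sum>k. f k v)"
    by (rule integrable_suminf[OF int_f summ norm_sum])
  then show "set_integrable lborel {0..1} (\<lambda>v. (v powr (- \<alpha> - 1) - v powr \<alpha>) / (1 - v))"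
    unfolding set_integrable_def real_scaleR_def
    by (subst integrable_cong_AE[OF _ meas]) (use ae in auto)
  have "(LINT v:{0..1}|lborel. (v powr (- \<alpha> - 1) - v powr \<alpha>) / (1 - v)) = (\<integral>v. (\<Sum>k. f k v) \<partial>lborel)"
    unfolding set_lebesgue_integral_def real_scaleR_def
    by (rule integral_cong_AE[OF _ meas]) (use ae in auto)
  also have "\<dots> = - (pi * cot (pi * \<alpha>))"
    using integral_suminf[OF int_f summ norm_sum] sums_unique[OF a_sums] by (simp add: val_f)
  finally show "(LINT v:{0..1}|lborel. (v powr (- \<alpha> - 1) - v powr \<alpha>) / (1 - v)) = - (pi * cot (pi * \<alpha>))" .
qed

text \<open>The pieces on the two sides of \<open>x\<close> are mapped into the unit interval by \<open>t = x u\<close> and \<open>t = x / v\<close>.\<close>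
lemma powr_kernel_left:
  fixes \<alpha> x \<epsilon> :: real
  assumes "\<alpha> > -1" "x > 0" "0 < \<epsilon>"
  shows "set_integrable lborel {0..x - \<epsilon>} (\<lambda>t. t powr \<alpha> / (t - x))"
    and "(LINT t:{0..x - \<epsilon>}|lborel. t powr \<alpha> / (t - x))
      = - (x powr \<alpha>) * (LINT v:{0..1 - \<epsilon> / x}|lborel. v powr \<alpha> / (1 - v))"
proof -
  let ?g = "\<lambda>t. t / x" and ?S = "{0..x - \<epsilon>}"
  let ?f = "\<lambda>v. v powr \<alpha> / (1 - v)"
  have im: "?g ` ?S = {0..1 - \<epsilon> / x}"
  proof (intro equalityI subsetI)
    fix v assume "v \<in> {0..1 - \<epsilon> / x}"
    then have "v = ?g (v * x)" "v * x \<in> ?S" using assms by (auto simp: field_simps)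
    then show "v \<in> ?g ` ?S" by blast
  qed (use assms in \<open>auto simp: field_simps\<close>)
  \<comment> \<open>Integrability is required for every \<epsilon> > 0; beyond \<open>x\<close> the
    domain is empty.\<close>
  have int: "set_integrable lborel (?g ` ?S) ?f"
  proof (cases "\<epsilon> \<le> x")
    case True
    then show ?thesis
      unfolding im using assms by (intro set_integrable_powr_div_one_minus) (auto simp: field_simps)
  next
    case False
    then show ?thesis by simp
  qed
  have eq: "t powr \<alpha> / (t - x) = - (x powr \<alpha>) * (\<bar>1 / x\<bar> * ?f (?g t))" if "t \<in> ?S" for t
  proof -
    have "?g t powr \<alpha> = t powr \<alpha> / x powr \<alpha>"
      by (rule powr_divide)
    then show ?thesis using that assms by (simp add: field_simps)
  qed
  note cov = set_lborel_change_of_variables[where g = ?g and g' = "\<lambda>_. 1 / x" and S = ?S and f = ?f]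
  have 1: "set_integrable lborel ?S (\<lambda>t. \<bar>1 / x\<bar> * ?f (?g t))"
    by (rule cov(1)) (use assms int im in \<open>auto intro!: derivative_eq_intros inj_onI\<close>)
  have 2: "(LINT t:?S|lborel. \<bar>1 / x\<bar> * ?f (?g t)) = (LINT v:{0..1 - \<epsilon> / x}|lborel. ?f v)"
    unfolding im[symmetric]
    by (rule cov(2)) (use assms int im in \<open>auto intro!: derivative_eq_intros inj_onI\<close>)
  show "set_integrable lborel {0..x - \<epsilon>} (\<lambda>t. t powr \<alpha> / (t - x))"
    using set_integrable_mult_right[OF 1, of "- (x powr \<alpha>)"]
    by (subst set_integrable_cong[OF refl refl eq])
  have "(LINT t:{0..x - \<epsilon>}|lborel. t powr \<alpha> / (t - x))
      = (LINT t:?S|lborel. - (x powr \<alpha>) * (\<bar>1 / x\<bar> * ?f (?g t)))"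
    by (rule set_lebesgue_integral_cong) (use eq in auto)
  also have "\<dots> = - (x powr \<alpha>) * (LINT v:{0..1 - \<epsilon> / x}|lborel. ?f v)"
    unfolding 2[symmetric] by (rule set_integral_mult_right)
  finally show "(LINT t:{0..x - \<epsilon>}|lborel. t powr \<alpha> / (t - x))
      = - (x powr \<alpha>) * (LINT v:{0..1 - \<epsilon> / x}|lborel. ?f v)" .
qed

lemma powr_kernel_right:
  fixes \<alpha> x \<epsilon> :: real
  assumes "\<alpha> < 0" "x > 0" "0 < \<epsilon>"
  shows "set_integrable lborel {x + \<epsilon>..} (\<lambda>t. t powr \<alpha> / (t - x))"
    and "(LINT t:{x + \<epsilon>..}|lborel. t powr \<alpha> / (t - x))
      = x powr \<alpha> * (LINT v:{0..x / (x + \<epsilon>)}|lborel. v powr (- \<alpha> - 1) / (1 - v))"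
proof -
  let ?g = "\<lambda>t. x / t" and ?S = "{x + \<epsilon>..}" and ?T = "{0..x / (x + \<epsilon>)}"
  let ?f = "\<lambda>v. v powr (- \<alpha> - 1) / (1 - v)"
  \<comment> \<open>The point v = 0 corresponds to t at infinity and is not attained; it is restored
    later as a null set.\<close>
  have im: "?g ` ?S = ?T - {0}"
  proof (intro equalityI subsetI)
    fix v assume v: "v \<in> ?T - {0}"
    then have "v * (x + \<epsilon>) \<le> x" using assms by (auto simp: field_simps)
    then have "v = ?g (x / v)" "x / v \<in> ?S" using v assms by (auto simp: field_simps)
    then show "v \<in> ?g ` ?S" by blast
  qed (use assms in \<open>auto intro!: divide_left_mono mult_pos_pos\<close>)
  have intT: "set_integrable lborel ?T ?f"
    using assms by (intro set_integrable_powr_div_one_minus) (auto simp: field_simps)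
  then have int: "set_integrable lborel (?g ` ?S) ?f"
    unfolding im by (rule set_integrable_subset) auto
  have eq: "t powr \<alpha> / (t - x) = x powr \<alpha> * (\<bar>- x / t\<^sup>2\<bar> * ?f (?g t))" if "t \<in> ?S" for t
  proof -
    have t: "t > 0" "t > x" using that assms by auto
    have "?g t powr (- \<alpha> - 1) = x powr (- \<alpha> - 1) / t powr (- \<alpha> - 1)"
      by (rule powr_divide)
    also have "\<dots> = (t powr \<alpha> * t) / (x powr \<alpha> * x)"
      using t assms by (simp add: powr_diff powr_minus field_simps)
    finally have p: "?g t powr (- \<alpha> - 1) = (t powr \<alpha> * t) / (x powr \<alpha> * x)" .
    have q: "1 - ?g t = (t - x) / t" using t by (simp add: field_simps)
    show ?thesis unfolding p q using t assms by (simp add: power2_eq_square)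
  qed
  note cov = set_lborel_change_of_variables[where g = ?g and g' = "\<lambda>t. - x / t\<^sup>2" and S = ?S and f = ?f]
  have der: "(?g has_field_derivative - x / t\<^sup>2) (at t within ?S)" if "t \<in> ?S" for t
    using that assms by (auto intro!: derivative_eq_intros simp: power2_eq_square)
  have inj: "inj_on ?g ?S"
    using assms by (auto simp: inj_on_def)
  have 1: "set_integrable lborel ?S (\<lambda>t. \<bar>- x / t\<^sup>2\<bar> * ?f (?g t))"
    by (rule cov(1)[OF _ _ _ _ der inj int]) (auto simp: im)
  have "(LINT t:?S|lborel. \<bar>- x / t\<^sup>2\<bar> * ?f (?g t)) = (LINT v:?g ` ?S|lborel. ?f v)"
    by (rule cov(2)[OF _ _ _ _ der inj int]) (auto simp: im)
  also have "\<dots> = (LINT v:?T|lborel. ?f v)"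
    unfolding im by (rule set_integral_discrete_difference[where X = "{0}"]) auto
  finally have 2: "(LINT t:?S|lborel. \<bar>- x / t\<^sup>2\<bar> * ?f (?g t)) = (LINT v:?T|lborel. ?f v)" .
  show "set_integrable lborel {x + \<epsilon>..} (\<lambda>t. t powr \<alpha> / (t - x))"
    using set_integrable_mult_right[OF 1, of "x powr \<alpha>"]
    by (subst set_integrable_cong[OF refl refl eq])
  have "(LINT t:{x + \<epsilon>..}|lborel. t powr \<alpha> / (t - x))
      = (LINT t:?S|lborel. x powr \<alpha> * (\<bar>- x / t\<^sup>2\<bar> * ?f (?g t)))"
    by (rule set_lebesgue_integral_cong) (use eq in auto)
  also have "\<dots> = x powr \<alpha> * (LINT v:?T|lborel. ?f v)"
    unfolding 2[symmetric] by (rule set_integral_mult_right)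
  finally show "(LINT t:{x + \<epsilon>..}|lborel. t powr \<alpha> / (t - x)) = x powr \<alpha> * (LINT v:?T|lborel. ?f v)" .
qed

text \<open>After substitution the two sides carry v^\<alpha> up to 1 - \<epsilon>/x and
  v^(-\<alpha>-1) up to x / (x + \<epsilon>). These endpoints differ only by order \<epsilon>^2,
  while the integrand in between is of order 1/\<epsilon>. So the mismatch disappears in the limit
  and the symmetrized integral remains.\<close>

lemma has_pv_powr:
  fixes \<alpha> x :: real
  assumes "-1 < \<alpha>" "\<alpha> < 0" "x > 0"
  shows "has_pv (\<lambda>t. t powr \<alpha> / (t - x)) x (- (pi * cot (pi * \<alpha>)) * x powr \<alpha>)"
proof -
  let ?f = "\<lambda>v. v powr (- \<alpha> - 1) / (1 - v)" and ?e = "\<lambda>v. v powr \<alpha> / (1 - v)"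
  let ?h = "\<lambda>v. (v powr (- \<alpha> - 1) - v powr \<alpha>) / (1 - v)"
  let ?q = "\<lambda>\<epsilon>. 1 - \<epsilon> / x" and ?p = "\<lambda>\<epsilon>. x / (x + \<epsilon>)"
  have sub: "{q<..p} \<subseteq> {0..p}" "{0..q} \<subseteq> {0..p}" "{0..p} = {0..q} \<union> {q<..p}" "{0..q} \<inter> {q<..p} = {}" if "0 \<le> q" "q < p" for q p :: real
    using that by auto
  have const: "(LINT v:{q<..p}|lborel. c) = (p - q) * c" if "q < p" for q p c :: real
    using that by (subst set_integral_const) auto
  have constI: "set_integrable lborel {q<..p} (\<lambda>v. c)" if "q < p" for q p c :: real
    unfolding set_integrable_def using that
    by (intro integrable_scaleR_left integrable_real_indicator) auto
  \<comment> \<open>The excess of the right side over the range common to both sides.\<close>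
  define E where "E \<epsilon> = (LINT v:{?q \<epsilon><..?p \<epsilon>}|lborel. ?f v)" for \<epsilon>
  have ev: "\<forall>\<^sub>F \<epsilon> in at_right 0. 0 < \<epsilon> \<and> \<epsilon> < x / 2"
    using assms by (intro eventually_conj eventually_at_right_less eventually_at_right_real[THEN eventually_mono, of 0 "x/2"]) auto
  have qp: "0 \<le> ?q \<epsilon>" "1/2 < ?q \<epsilon>" "?q \<epsilon> < ?p \<epsilon>" "?p \<epsilon> < 1" "?p \<epsilon> - ?q \<epsilon> = \<epsilon>\<^sup>2 / (x * (x + \<epsilon>))" "1 - ?p \<epsilon> = \<epsilon> / (x + \<epsilon>)"
    if "0 < \<epsilon>" "\<epsilon> < x / 2" for \<epsilon>
  proof -
    show d: "?p \<epsilon> - ?q \<epsilon> = \<epsilon>\<^sup>2 / (x * (x + \<epsilon>))"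
      using that assms by (simp add: divide_simps) (simp add: algebra_simps power2_eq_square)
    have "\<epsilon>\<^sup>2 / (x * (x + \<epsilon>)) > 0" using that assms by (intro divide_pos_pos mult_pos_pos) auto
    with d show "?q \<epsilon> < ?p \<epsilon>" by linarith
  qed (use that assms in \<open>auto simp: field_simps\<close>)
  have intf: "set_integrable lborel {0..?p \<epsilon>} ?f" if "0 < \<epsilon>" "\<epsilon> < x / 2" for \<epsilon>
    using that assms qp[OF that] by (intro set_integrable_powr_div_one_minus) auto
  have E_bounds: "0 \<le> E \<epsilon> \<and> E \<epsilon> \<le> (1/2) powr (- \<alpha> - 1) * (\<epsilon> / x)" if "0 < \<epsilon>" "\<epsilon> < x / 2" for \<epsilon>
  proof
    note Q = qp[OF that]
    show "0 \<le> E \<epsilon>"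
      unfolding E_def set_lebesgue_integral_def using Q
      by (intro Bochner_Integration.integral_nonneg) (auto simp: indicator_def)
    \<comment> \<open>The condition \<epsilon> < x / 2 gives v > 1/2, where the decreasing power is
      at most its value at 1/2; the other factor bounds 1 / (1 - v) by its value at the right
      endpoint.\<close>
    let ?c = "(1/2) powr (- \<alpha> - 1) * ((x + \<epsilon>) / \<epsilon>)"
    have "E \<epsilon> \<le> (LINT v:{?q \<epsilon><..?p \<epsilon>}|lborel. ?c)"
      unfolding E_def
    proof (rule set_integral_mono)
      show "set_integrable lborel {?q \<epsilon><..?p \<epsilon>} ?f"
        by (rule set_integrable_subset[OF intf[OF that] _ sub(1)[OF Q(1,3)]]) simp
      show "set_integrable lborel {?q \<epsilon><..?p \<epsilon>} (\<lambda>v. ?c)"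
        by (rule constI[OF Q(3)])
      fix v assume v: "v \<in> {?q \<epsilon><..?p \<epsilon>}"
      have "?q \<epsilon> < v" using v by (simp only: greaterThanAtMost_iff)
      then have hv: "1/2 \<le> v" using Q(2) by linarith
      have "v \<le> ?p \<epsilon>" using v by (simp only: greaterThanAtMost_iff)
      then have hv1: "v < 1" using Q(4) by linarith
      from hv have "v powr (- \<alpha> - 1) \<le> (1/2) powr (- \<alpha> - 1)"
        using assms by (intro powr_mono2') auto
      moreover have "1 / (1 - v) \<le> 1 / (1 - ?p \<epsilon>)"
        using v Q(4) by (intro divide_left_mono mult_pos_pos) (auto simp del: divide_less_eq_1_pos)
      then have "1 / (1 - v) \<le> (x + \<epsilon>) / \<epsilon>" unfolding Q(6) by simp
      ultimately have "v powr (- \<alpha> - 1) * (1 / (1 - v)) \<le> ?c"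
        using hv hv1 that assms by (intro mult_mono) auto
      then show "v powr (- \<alpha> - 1) / (1 - v) \<le> ?c" by simp
    qed
    also have "\<dots> = (?p \<epsilon> - ?q \<epsilon>) * ?c"
      by (rule const[OF Q(3)])
    also have "\<dots> = (1/2) powr (- \<alpha> - 1) * (\<epsilon> / x)"
    proof -
      have h: "\<epsilon>\<^sup>2 / (x * s) * (h * (s / \<epsilon>)) = h * (\<epsilon> / x)" if "s \<noteq> 0" for s h
        using that \<open>0 < \<epsilon>\<close> by (simp add: power2_eq_square)
      show ?thesis unfolding Q(5) by (rule h) (use that assms in simp)
    qed
    finally show "E \<epsilon> \<le> (1/2) powr (- \<alpha> - 1) * (\<epsilon> / x)" .
  qed
  have "(E \<longlongrightarrow> 0) (at_right 0)"
  proof (rule tendsto_sandwich[where f = "\<lambda>_. 0"])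
    show "\<forall>\<^sub>F \<epsilon> in at_right 0. 0 \<le> E \<epsilon>"
      using ev by eventually_elim (use E_bounds in blast)
    show "\<forall>\<^sub>F \<epsilon> in at_right 0. E \<epsilon> \<le> (1/2) powr (- \<alpha> - 1) * (\<epsilon> / x)"
      using ev by eventually_elim (use E_bounds in blast)
    show "((\<lambda>\<epsilon>. (1/2) powr (- \<alpha> - 1) * (\<epsilon> / x)) \<longlongrightarrow> 0) (at_right 0)"
      using assms(3) by (auto intro!: tendsto_eq_intros)
  qed simp
  moreover have "((\<lambda>\<epsilon>. LINT v:{0..?q \<epsilon>}|lborel. ?h v) \<longlongrightarrow> (LINT v:{0..<1}|lborel. ?h v)) (at_right 0)"
  proof (rule filterlim_compose[OF tendsto_set_lebesgue_integral_at_left])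
    show "set_integrable lborel {0..<1} ?h"
      by (rule set_integrable_subset[OF integral_powr_kernel_symmetrized(1)]) (use assms in auto)
    show "filterlim ?q (at_left 1) (at_right 0)"
      unfolding filterlim_at using assms eventually_at_right_less[of "0::real"]
      by (auto intro!: tendsto_eq_intros elim!: eventually_mono)
  qed auto
  moreover have "(LINT v:{0..<1}|lborel. ?h v) = (LINT v:{0..1}|lborel. ?h v)"
    by (rule set_integral_discrete_difference[where X = "{1}"]) auto
  ultimately have "((\<lambda>\<epsilon>. x powr \<alpha> * ((LINT v:{0..?q \<epsilon>}|lborel. ?h v) + E \<epsilon>))
      \<longlongrightarrow> x powr \<alpha> * (- (pi * cot (pi * \<alpha>)) + 0)) (at_right 0)"
    using integral_powr_kernel_symmetrized(2)[OF assms(1,2)] by (intro tendsto_intros) simp_all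
  moreover have "\<forall>\<^sub>F \<epsilon> in at_right 0. x powr \<alpha> * ((LINT v:{0..?q \<epsilon>}|lborel. ?h v) + E \<epsilon>)
     = (LINT t:{0..x - \<epsilon>}|lborel. t powr \<alpha> / (t - x)) + (LINT t:{x + \<epsilon>..}|lborel. t powr \<alpha> / (t - x))"
    using ev
  proof eventually_elim
    case (elim \<epsilon>)
    then have e: "0 < \<epsilon>" "\<epsilon> < x / 2" by auto
    note Q = qp[OF e]
    have f0: "set_integrable lborel {0..?q \<epsilon>} ?f"
      by (rule set_integrable_subset[OF intf[OF e] _ sub(2)[OF Q(1,3)]]) simp
    have f1: "set_integrable lborel {?q \<epsilon><..?p \<epsilon>} ?f"
      by (rule set_integrable_subset[OF intf[OF e] _ sub(1)[OF Q(1,3)]]) simp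
    have g0: "set_integrable lborel {0..?q \<epsilon>} ?e"
      using Q assms by (intro set_integrable_powr_div_one_minus) auto
    have "{0..?p \<epsilon>} = {0..?q \<epsilon>} \<union> {?q \<epsilon><..?p \<epsilon>}" by (rule sub(3)[OF Q(1,3)])
    then have "(LINT v:{0..?p \<epsilon>}|lborel. ?f v) = (LINT v:{0..?q \<epsilon>}|lborel. ?f v) + E \<epsilon>"
      unfolding E_def using set_integral_Un[OF sub(4)[OF Q(1,3)] f0 f1] by simp
    moreover have "(LINT v:{0..?q \<epsilon>}|lborel. ?h v) = (LINT v:{0..?q \<epsilon>}|lborel. ?f v) - (LINT v:{0..?q \<epsilon>}|lborel. ?e v)"
      unfolding diff_divide_distrib by (rule set_integral_diff(2)[OF f0 g0])
    ultimately have p: "(LINT v:{0..?p \<epsilon>}|lborel. ?f v) = (LINT v:{0..?q \<epsilon>}|lborel. ?h v) + (LINT v:{0..?q \<epsilon>}|lborel. ?e v) + E \<epsilon>"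
      by simp
    show ?case
      unfolding powr_kernel_left(2)[OF assms(1,3) e(1)] powr_kernel_right(2)[OF assms(2,3) e(1)] p
      by (simp add: algebra_simps)
  qed
  ultimately have "((\<lambda>\<epsilon>. (LINT t:{0..x - \<epsilon>}|lborel. t powr \<alpha> / (t - x)) + (LINT t:{x + \<epsilon>..}|lborel. t powr \<alpha> / (t - x)))
      \<longlongrightarrow> x powr \<alpha> * (- (pi * cot (pi * \<alpha>)) + 0)) (at_right 0)"
    by (rule Lim_transform_eventually)
  then show ?thesis
    unfolding has_pv_def
    using powr_kernel_left(1)[OF assms(1,3)] powr_kernel_right(1)[OF assms(2,3)]
    by (simp add: mult.commute)
qed

section \<open>The regular part of the integrand\<close>

text \<open>The parameters differ by 1, so the quotient of Pochhammer symbols telescopes. The factor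
  1 / (k - \<alpha>) is what the integral of \<open>s powr (k - \<alpha> - 1)\<close> over the unit
  interval produces.\<close>

lemma hyp_coeff_shift:
  assumes "\<alpha> \<notin> \<nat>"
  shows "hyp_coeff (- \<alpha>) (1 - \<alpha>) k = - \<alpha> / ((real k - \<alpha>) * fact k)"
proof -
  have nz: "pochhammer (1 - \<alpha>) k \<noteq> 0"
    using one_minus_notin_nonpos_Ints[OF assms] by (auto simp: pochhammer_eq_0_iff)
  have "real k - \<alpha> \<noteq> 0" using assms by (metis eq_iff_diff_eq_0 of_nat_in_Nats)
  moreover have "pochhammer (- \<alpha>) k * (real k - \<alpha>) = - \<alpha> * pochhammer (1 - \<alpha>) k"
    using pochhammer_rec[of "- \<alpha>" k] pochhammer_Suc[of "- \<alpha>" k] by (simp add: algebra_simps)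
  ultimately have "pochhammer (- \<alpha>) k = - \<alpha> * pochhammer (1 - \<alpha>) k / (real k - \<alpha>)"
    by (subst nonzero_eq_divide_eq) simp_all
  then show ?thesis
    using nz by (simp add: hyp_coeff_def)
qed

lemma Gamma_confluent_hyp_sums:
  assumes "\<alpha> > -1" "\<alpha> \<notin> \<nat>"
  shows "(\<lambda>k. Gamma (\<alpha> + 1) * (x ^ k / (fact k * (real k - \<alpha>)))) sums
     (- Gamma \<alpha> * confluent_hyp (- \<alpha>) (1 - \<alpha>) x)"
proof -
  have "\<alpha> \<notin> \<int>\<^sub>\<le>\<^sub>0" using assms by (auto elim!: nonpos_Ints_cases')
  then have "Gamma (\<alpha> + 1) = \<alpha> * Gamma \<alpha>" by (rule Gamma_plus1)
  then have "Gamma (\<alpha> + 1) * (x ^ k / (fact k * (real k - \<alpha>)))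
     = - Gamma \<alpha> * (hyp_coeff (- \<alpha>) (1 - \<alpha>) k * x ^ k)" for k
    by (simp add: hyp_coeff_shift[OF assms(2)] mult_ac)
  then show ?thesis
    using sums_mult[OF confluent_hyp_sums[of "- \<alpha>" "1 - \<alpha>" x], of "- Gamma \<alpha>"] by simp
qed

lemma nn_integral_exp_segment:
  fixes d :: real
  assumes "d \<noteq> 0"
  shows "(\<integral>\<^sup>+s. ennreal (exp (- (s * d))) * indicator {0..1} s \<partial>lborel) = ennreal ((1 - exp (- d)) / d)"
proof -
  have "(\<integral>\<^sup>+s. ennreal (exp (- (s * d))) * indicator {0..1} s \<partial>lborel)
      = ennreal (- exp (- (1 * d)) / d - - exp (- (0 * d)) / d)"
    by (rule nn_integral_FTC_Icc) (use assms in \<open>auto intro!: derivative_eq_intros\<close>)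
  then show ?thesis by (simp add: diff_divide_distrib)
qed

text \<open>Writing \<open>(1 - exp (- d)) / d\<close> as the integral of \<open>exp (- s d)\<close> over \<open>s\<close> in the unit interval
  and exchanging the integrations leaves a Gamma integral in \<open>t\<close>.\<close>
lemma powr_exp_quotient_integral:
  fixes \<alpha> x :: real
  assumes "-1 < \<alpha>" "\<alpha> < 0" "x > 0"
  shows "set_integrable lborel {0..} (\<lambda>t. t powr \<alpha> * ((1 - exp (- (t - x))) / (t - x)))"
    and "(LINT t:{0..}|lborel. t powr \<alpha> * ((1 - exp (- (t - x))) / (t - x)))
      = - Gamma \<alpha> * confluent_hyp (- \<alpha>) (1 - \<alpha>) x"
proof -
  have nat: "\<alpha> \<notin> \<nat>" using assms by (auto elim!: Nats_cases)
  have G: "Gamma (\<alpha> + 1) > 0" using assms by (intro Gamma_real_pos) simp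
  let ?h = "\<lambda>t. indicat_real {0..} t * (t powr \<alpha> * ((1 - exp (- (t - x))) / (t - x)))"
  let ?F = "\<lambda>t s. indicat_real {0..} t * (t powr \<alpha> * exp (- (s * (t - x)))) * indicat_real {0..1} s"
  define c where "c k = Gamma (\<alpha> + 1) * (x ^ k / (fact k * (real k - \<alpha>)))" for k
  have c0: "c k \<ge> 0" for k
    unfolding c_def using G assms by auto
  have c_sums: "c sums (- Gamma \<alpha> * confluent_hyp (- \<alpha>) (1 - \<alpha>) x)"
    unfolding c_def by (rule Gamma_confluent_hyp_sums) (use assms nat in auto)
  \<comment> \<open>Numerator and denominator of (1 - e^(-d)) / d have the same sign. Hence the
    whole computation can run in nonnegative integrals, and integrability follows at the end from
    the finite value.\<close>
  have h0: "?h t \<ge> 0" for t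
  proof -
    have q: "(1 - exp (- d)) / d \<ge> 0" for d :: real
      by (cases "d \<ge> 0") (auto intro: divide_nonpos_neg)
    show ?thesis by (intro mult_nonneg_nonneg q) simp_all
  qed
  have "(\<integral>\<^sup>+t. ennreal (?h t) \<partial>lborel) = (\<integral>\<^sup>+t. \<integral>\<^sup>+s. ennreal (?F t s) \<partial>lborel \<partial>lborel)"
  proof (rule nn_integral_cong_AE)
    \<comment> \<open>At t = x the quotient is 0 by division by zero, whereas the integral over
      \<open>s\<close> is positive; this single point is discarded.\<close>
    show "AE t in lborel. ennreal (?h t) = (\<integral>\<^sup>+s. ennreal (?F t s) \<partial>lborel)"
      using AE_lborel_singleton[of x]
    proof eventually_elim
      case (elim t)
      have "(\<integral>\<^sup>+s. ennreal (?F t s) \<partial>lborel)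
         = (\<integral>\<^sup>+s. ennreal (indicat_real {0..} t * t powr \<alpha>) * (ennreal (exp (- (s * (t - x)))) * indicator {0..1} s) \<partial>lborel)"
        by (intro nn_integral_cong) (auto simp: ennreal_mult[symmetric] indicator_def mult.assoc)
      also have "\<dots> = ennreal (indicat_real {0..} t * t powr \<alpha>) * ennreal ((1 - exp (- (t - x))) / (t - x))"
        using elim by (subst nn_integral_cmult) (simp_all only: nn_integral_exp_segment[of "t - x"], auto)
      also have "\<dots> = ennreal (?h t)"
        by (subst ennreal_mult'[symmetric]) (auto simp: mult.assoc)
      finally show ?case ..
    qed
  qed
  also have "\<dots> = (\<integral>\<^sup>+s. \<integral>\<^sup>+t. ennreal (?F t s) \<partial>lborel \<partial>lborel)"
    by (rule lborel_pair.Fubini'[symmetric]) (auto simp: case_prod_unfold indicator_def cong: measurable_cong_sets)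
  also have "\<dots> = (\<integral>\<^sup>+s. (\<Sum>k. ennreal (Gamma (\<alpha> + 1) * x ^ k / fact k) * ennreal (indicat_real {0..1} s * s powr (real k - \<alpha> - 1))) \<partial>lborel)"
  proof (rule nn_integral_cong_AE)
    \<comment> \<open>For s = 0 the integral over \<open>t\<close> is infinite, so this point is
      discarded as well.\<close>
    show "AE s in lborel. (\<integral>\<^sup>+t. ennreal (?F t s) \<partial>lborel)
      = (\<Sum>k. ennreal (Gamma (\<alpha> + 1) * x ^ k / fact k) * ennreal (indicat_real {0..1} s * s powr (real k - \<alpha> - 1)))"
      using AE_lborel_singleton[of 0]
    proof eventually_elim
      case (elim s)
      show ?case
      proof (cases "s \<in> {0..1}")
        case True
        with elim have s: "0 < s" "s \<le> 1" by auto
        have "(\<integral>\<^sup>+t. ennreal (?F t s) \<partial>lborel)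
            = (\<integral>\<^sup>+t. ennreal (exp (s * x)) * ennreal (indicator {0..} t * (t powr \<alpha> * exp (- (s * t)))) \<partial>lborel)"
        proof (rule nn_integral_cong)
          fix t :: real
          have "exp (- (s * (t - x))) = exp (s * x) * exp (- (s * t))"
            by (simp add: mult_exp_exp algebra_simps)
          then have "?F t s = exp (s * x) * (indicator {0..} t * (t powr \<alpha> * exp (- (s * t))))"
            using True by (simp only: indicator_simps mult_1_right mult_ac)
          then show "ennreal (?F t s) = ennreal (exp (s * x)) * ennreal (indicator {0..} t * (t powr \<alpha> * exp (- (s * t))))"
            by (simp only:) (rule ennreal_mult'[OF exp_ge_zero])
        qed
        also have "\<dots> = ennreal (exp (s * x)) * ennreal (Gamma (\<alpha> + 1) * s powr (- \<alpha> - 1))"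
          unfolding nn_integral_Gamma_scaled[OF assms(1) s(1), symmetric]
          by (rule nn_integral_cmult) simp
        also have "\<dots> = ennreal (Gamma (\<alpha> + 1) * s powr (- \<alpha> - 1) * exp (s * x))"
          using G by (simp add: ennreal_mult[symmetric] mult_ac)
        \<comment> \<open>Expanding e^(s x) turns the integral over \<open>s\<close> into a series
          of pure powers, whose exponents exceed -1 because \<alpha> < 0.\<close>
        also have "\<dots> = (\<Sum>k. ennreal (Gamma (\<alpha> + 1) * x ^ k / fact k * (s powr (real k - \<alpha> - 1))))"
        proof (rule suminf_ennreal_eq[symmetric])
          show "0 \<le> Gamma (\<alpha> + 1) * x ^ k / fact k * (s powr (real k - \<alpha> - 1))" for k
            using G assms by auto
          have "Gamma (\<alpha> + 1) * x ^ k / fact k * (s powr (real k - \<alpha> - 1))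
             = Gamma (\<alpha> + 1) * s powr (- \<alpha> - 1) * ((s * x) ^ k /\<^sub>R fact k)" for k
          proof -
            have "s powr (real k - \<alpha> - 1) = s ^ k * s powr (- \<alpha> - 1)"
              using s by (simp add: powr_realpow[symmetric] powr_add[symmetric] algebra_simps)
            then show ?thesis by (simp add: power_mult_distrib field_simps)
          qed
          then show "(\<lambda>k. Gamma (\<alpha> + 1) * x ^ k / fact k * (s powr (real k - \<alpha> - 1)))
              sums (Gamma (\<alpha> + 1) * s powr (- \<alpha> - 1) * exp (s * x))"
            using sums_mult[OF exp_converges[of "s * x"], of "Gamma (\<alpha> + 1) * s powr (- \<alpha> - 1)"] by simp
        qed
        also have "\<dots> = (\<Sum>k. ennreal (Gamma (\<alpha> + 1) * x ^ k / fact k) * ennreal (indicat_real {0..1} s * s powr (real k - \<alpha> - 1)))"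
        proof (rule suminf_cong)
          fix k
          have "0 \<le> Gamma (\<alpha> + 1) * x ^ k / fact k" using G assms by simp
          then show "ennreal (Gamma (\<alpha> + 1) * x ^ k / fact k * (s powr (real k - \<alpha> - 1)))
            = ennreal (Gamma (\<alpha> + 1) * x ^ k / fact k) * ennreal (indicat_real {0..1} s * s powr (real k - \<alpha> - 1))"
            using True by (simp only: indicator_simps mult_1_left ennreal_mult')
        qed
        finally show ?thesis .
      qed simp
    qed
  qed
  also have "\<dots> = (\<Sum>k. \<integral>\<^sup>+s. ennreal (Gamma (\<alpha> + 1) * x ^ k / fact k) * ennreal (indicat_real {0..1} s * s powr (real k - \<alpha> - 1)) \<partial>lborel)"
    by (rule nn_integral_suminf) auto
  also have "\<dots> = (\<Sum>k. ennreal (c k))"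
  proof (rule suminf_cong)
    fix k
    have "real k - \<alpha> > 0" using assms by simp
    then have "(\<integral>\<^sup>+s. ennreal (indicat_real {0..1} s * s powr (real k - \<alpha> - 1)) \<partial>lborel) = ennreal (1 / (real k - \<alpha>))"
      using nn_integral_has_integral_lebesgue[OF _ has_integral_powr_from_0[of "real k - \<alpha> - 1" 1]] by simp
    then have "(\<integral>\<^sup>+s. ennreal (Gamma (\<alpha> + 1) * x ^ k / fact k) * ennreal (indicat_real {0..1} s * s powr (real k - \<alpha> - 1)) \<partial>lborel)
      = ennreal (Gamma (\<alpha> + 1) * x ^ k / fact k) * ennreal (1 / (real k - \<alpha>))"
      by (subst nn_integral_cmult) auto
    also have "\<dots> = ennreal (c k)"
    proof -
      have "0 \<le> Gamma (\<alpha> + 1) * x ^ k / fact k" using G assms by simp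
      then have "ennreal (Gamma (\<alpha> + 1) * x ^ k / fact k) * ennreal (1 / (real k - \<alpha>))
          = ennreal (Gamma (\<alpha> + 1) * x ^ k / fact k * (1 / (real k - \<alpha>)))"
        by (rule ennreal_mult'[symmetric])
      then show ?thesis by (simp add: c_def)
    qed
    finally show "(\<integral>\<^sup>+s. ennreal (Gamma (\<alpha> + 1) * x ^ k / fact k) * ennreal (indicat_real {0..1} s * s powr (real k - \<alpha> - 1)) \<partial>lborel)
      = ennreal (c k)" .
  qed
  also have "\<dots> = ennreal (- Gamma \<alpha> * confluent_hyp (- \<alpha>) (1 - \<alpha>) x)"
    by (rule suminf_ennreal_eq[OF c0 c_sums])
  finally have nn: "(\<integral>\<^sup>+t. ennreal (?h t) \<partial>lborel) = ennreal (- Gamma \<alpha> * confluent_hyp (- \<alpha>) (1 - \<alpha>) x)" .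
  have "0 \<le> - Gamma \<alpha> * confluent_hyp (- \<alpha>) (1 - \<alpha>) x"
    using suminf_nonneg[OF sums_summable[OF c_sums] c0] sums_unique[OF c_sums] by simp
  then have "has_bochner_integral lborel ?h (- Gamma \<alpha> * confluent_hyp (- \<alpha>) (1 - \<alpha>) x)"
    by (intro has_bochner_integral_nn_integral[OF _ AE_I2[OF h0] _ nn]) simp_all
  then show "set_integrable lborel {0..} (\<lambda>t. t powr \<alpha> * ((1 - exp (- (t - x))) / (t - x)))"
    and "(LINT t:{0..}|lborel. t powr \<alpha> * ((1 - exp (- (t - x))) / (t - x)))
      = - Gamma \<alpha> * confluent_hyp (- \<alpha>) (1 - \<alpha>) x"
    unfolding set_integrable_def set_lebesgue_integral_def has_bochner_integral_iff real_scaleR_def by auto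
qed

section \<open>The weight in the strip, and the shift of \<alpha>\<close>

lemma has_pv_laguerre_weight_neg:
  fixes \<alpha> x :: real
  assumes "-1 < \<alpha>" "\<alpha> < 0" "x > 0"
  shows "has_pv (\<lambda>t. laguerre_weight \<alpha> t / (t - x)) x (pi * laguerre_Q 0 \<alpha> x)"
proof -
  note has_pv_integrable[OF powr_exp_quotient_integral(1)[OF assms] assms(3)]
  from has_pv_diff[OF has_pv_powr[OF assms] this]
  have "has_pv (\<lambda>t. exp (- x) * (t powr \<alpha> / (t - x) - t powr \<alpha> * ((1 - exp (- (t - x))) / (t - x)))) x
     (exp (- x) * (- (pi * cot (pi * \<alpha>)) * x powr \<alpha> - - Gamma \<alpha> * confluent_hyp (- \<alpha>) (1 - \<alpha>) x))"
    unfolding powr_exp_quotient_integral(2)[OF assms] by (rule has_pv_cmult)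
  moreover have "exp (- x) * (t powr \<alpha> / (t - x) - t powr \<alpha> * ((1 - exp (- (t - x))) / (t - x)))
      = laguerre_weight \<alpha> t / (t - x)" for t
  proof -
    have "exp (- x) * exp (- (t - x)) = exp (- t)" by (simp add: mult_exp_exp)
    then have "laguerre_weight \<alpha> t = t powr \<alpha> * (exp (- x) * exp (- (t - x)))"
      by (simp add: laguerre_weight_def)
    then show ?thesis
      by (simp only: diff_divide_distrib algebra_simps times_divide_eq_right)
  qed
  moreover have "exp (- x) * (- (pi * cot (pi * \<alpha>)) * x powr \<alpha> - - Gamma \<alpha> * confluent_hyp (- \<alpha>) (1 - \<alpha>) x)
      = pi * laguerre_Q 0 \<alpha> x"
    by (simp add: laguerre_Q_def algebra_simps)
  ultimately show ?thesis by simp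
qed

text \<open>Counterpart of t^(\<alpha>+1) / (t - x) = x t^\<alpha> / (t - x) + t^\<alpha>, whose
  last term integrates to \<open>Gamma (\<alpha> + 1)\<close>. In the series, term k + 1 for
  \<alpha> + 1 plus that of the scaled exponential is \<open>x\<close> times term k for \<alpha>,
  and the constant terms cancel; the cotangent is periodic.\<close>

lemma laguerre_Q_0_shift:
  assumes "\<alpha> > -1" "\<alpha> \<notin> \<nat>" "x > 0"
  shows "pi * laguerre_Q 0 (\<alpha> + 1) x = x * (pi * laguerre_Q 0 \<alpha> x) + Gamma (\<alpha> + 1)"
proof -
  have \<alpha>': "\<alpha> + 1 > -1" "\<alpha> + 1 \<notin> \<nat>"
  proof -
    show "\<alpha> + 1 \<notin> \<nat>"
    proof
      assume "\<alpha> + 1 \<in> \<nat>"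
      then obtain k where k: "\<alpha> + 1 = real k" by (auto elim: Nats_cases)
      with assms(1) have "k > 0" by (cases k) auto
      with k have "\<alpha> = real (k - 1)" by simp
      with assms(2) show False by (metis of_nat_in_Nats)
    qed
  qed (use assms in simp)
  have nz: "real k - \<alpha> \<noteq> 0" for k using assms(2) by (metis eq_iff_diff_eq_0 of_nat_in_Nats)
  have "\<alpha> + 1 \<notin> \<int>\<^sub>\<le>\<^sub>0" using assms(1) by (auto elim!: nonpos_Ints_cases')
  then have G: "Gamma (\<alpha> + 1 + 1) = (\<alpha> + 1) * Gamma (\<alpha> + 1)" by (rule Gamma_plus1)
  let ?A = "- Gamma \<alpha> * confluent_hyp (- \<alpha>) (1 - \<alpha>) x"
  let ?B = "- Gamma (\<alpha> + 1) * confluent_hyp (- (\<alpha> + 1)) (1 - (\<alpha> + 1)) x"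
  define a where "a k = Gamma (\<alpha> + 1) * (x ^ k / (fact k * (real k - \<alpha>)))" for k
  define b where "b k = Gamma (\<alpha> + 1 + 1) * (x ^ k / (fact k * (real k - (\<alpha> + 1))))" for k
  define e where "e k = Gamma (\<alpha> + 1) * (x ^ k /\<^sub>R fact k)" for k
  have a: "a sums ?A" unfolding a_def by (rule Gamma_confluent_hyp_sums[OF assms(1,2)])
  have b: "b sums ?B" unfolding b_def by (rule Gamma_confluent_hyp_sums[OF \<alpha>'])
  have e: "e sums (Gamma (\<alpha> + 1) * exp x)"
    unfolding e_def by (rule sums_mult[OF exp_converges])
  have "(\<lambda>k. b (Suc k) + e (Suc k)) sums (?B + Gamma (\<alpha> + 1) * exp x - (b 0 + e 0))"
    using sums_add[OF b e] sums_Suc_iff[of "\<lambda>k. b k + e k" "?B + Gamma (\<alpha> + 1) * exp x - (b 0 + e 0)"] by simp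
  moreover have "b (Suc k) + e (Suc k) = x * a k" for k
  proof -
    define y where "y = x ^ Suc k / fact (Suc k)"
    have "real (Suc k) - (\<alpha> + 1) = real k - \<alpha>" by simp
    then have "b (Suc k) = (\<alpha> + 1) * Gamma (\<alpha> + 1) * (y / (real k - \<alpha>))"
      unfolding b_def G y_def divide_divide_eq_left by (simp only:)
    moreover have "e (Suc k) = Gamma (\<alpha> + 1) * y"
      unfolding e_def y_def by (simp add: divide_inverse mult.commute)
    ultimately have "b (Suc k) + e (Suc k) = Gamma (\<alpha> + 1) * (x ^ Suc k / fact (Suc k)) * ((\<alpha> + 1) / (real k - \<alpha>) + 1)"
      unfolding y_def[symmetric] by (simp add: algebra_simps add_divide_distrib)
    also have "(\<alpha> + 1) / (real k - \<alpha>) + 1 = real (Suc k) / (real k - \<alpha>)"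
      using nz[of k] by (simp add: field_simps)
    also have "Gamma (\<alpha> + 1) * (x ^ Suc k / fact (Suc k)) * (real (Suc k) / (real k - \<alpha>)) = x * a k"
      unfolding a_def by (simp del: of_nat_Suc)
    finally show ?thesis .
  qed
  moreover have "b 0 + e 0 = 0"
    using assms(1) \<alpha>' unfolding b_def e_def G by (simp add: field_simps)
  ultimately have "(\<lambda>k. x * a k) sums (?B + Gamma (\<alpha> + 1) * exp x)" by simp
  with sums_mult[OF a, of x] have "x * ?A = ?B + Gamma (\<alpha> + 1) * exp x"
    by (rule sums_unique2)
  then have B: "Gamma (\<alpha> + 1) * confluent_hyp (- (\<alpha> + 1)) (1 - (\<alpha> + 1)) x
      = x * (Gamma \<alpha> * confluent_hyp (- \<alpha>) (1 - \<alpha>) x) + Gamma (\<alpha> + 1) * exp x"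
    by simp
  have cot: "cot (pi * (\<alpha> + 1)) = cot (pi * \<alpha>)"
    by (simp add: distrib_left cot_def)
  have pw: "x powr (\<alpha> + 1) = x * x powr \<alpha>"
    using assms(3) by (simp add: powr_add)
  have "pi * laguerre_Q 0 \<beta> x = exp (- x) * (Gamma \<beta> * confluent_hyp (- \<beta>) (1 - \<beta>) x) - pi * (cot (pi * \<beta>) * x powr \<beta> * exp (- x))" for \<beta>
    by (simp add: laguerre_Q_def algebra_simps)
  note Q = this
  have ex: "exp (- x) * (Gamma (\<alpha> + 1) * exp x) = Gamma (\<alpha> + 1)"
    by (simp add: mult_exp_exp)
  have "pi * laguerre_Q 0 (\<alpha> + 1) x = exp (- x) * (x * (Gamma \<alpha> * confluent_hyp (- \<alpha>) (1 - \<alpha>) x)) + exp (- x) * (Gamma (\<alpha> + 1) * exp x)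
     - pi * (cot (pi * \<alpha>) * (x * x powr \<alpha>) * exp (- x))"
    unfolding Q[of "\<alpha> + 1"] B cot pw by (simp only: distrib_left)
  then show ?thesis unfolding ex Q[of \<alpha>] by (simp add: algebra_simps)
qed

text \<open>Induction on an integer upper bound of \<alpha>, each step lowering \<alpha> by 1 until
  it is negative. Since \<alpha> = 0 is excluded, the descent stays strictly above -1.\<close>

lemma has_pv_laguerre_weight:
  assumes "\<alpha> > -1" "\<alpha> \<notin> \<nat>" "x > 0"
  shows "has_pv (\<lambda>t. laguerre_weight \<alpha> t / (t - x)) x (pi * laguerre_Q 0 \<alpha> x)"
proof -
  have "has_pv (\<lambda>t. laguerre_weight \<alpha> t / (t - x)) x (pi * laguerre_Q 0 \<alpha> x)"
    if "\<alpha> > -1" "\<alpha> \<notin> \<nat>" "\<alpha> < real m" for m \<alpha>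
    using that
  proof (induction m arbitrary: \<alpha>)
    case 0
    then show ?case using has_pv_laguerre_weight_neg[of \<alpha> x] assms(3) by simp
  next
    case (Suc m)
    show ?case
    proof (cases "\<alpha> < 0")
      case True
      then show ?thesis using has_pv_laguerre_weight_neg[of \<alpha> x] assms(3) Suc.prems by simp
    next
      case False
      define \<beta> where "\<beta> = \<alpha> - 1"
      have ab: "\<alpha> = \<beta> + 1" by (simp add: \<beta>_def)
      have "\<alpha> \<noteq> 0" using Suc.prems by auto
      with False have b: "\<beta> > -1" "\<beta> < real m" using Suc.prems by (auto simp: \<beta>_def)
      have bn: "\<beta> \<notin> \<nat>"
        using Suc.prems(2) Nats_add[OF _ Nats_1, of \<beta>] unfolding ab by blast
      note Suc.IH[OF b(1) bn b(2)]
      from has_pv_add[OF has_pv_cmult[OF this, of x] has_pv_integrable[OF set_integrable_Gamma(1)[OF b(1)] assms(3)]]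
      have "has_pv (\<lambda>t. x * (laguerre_weight \<beta> t / (t - x)) + t powr \<beta> * exp (- t)) x (pi * laguerre_Q 0 \<alpha> x)"
        unfolding set_integrable_Gamma(2)[OF b(1)] ab laguerre_Q_0_shift[OF b(1) bn assms(3)] .
      then show ?thesis
      proof (rule has_pv_cong[OF _ assms(3)])
        fix t :: real assume t: "t \<ge> 0" "t \<noteq> x"
        have "laguerre_weight \<alpha> t = t * laguerre_weight \<beta> t"
          using t powr_mult_base[of t \<beta>] by (simp add: laguerre_weight_def ab add.commute)
        then show "x * (laguerre_weight \<beta> t / (t - x)) + t powr \<beta> * exp (- t) = laguerre_weight \<alpha> t / (t - x)"
          using t unfolding laguerre_weight_def by (simp add: field_simps)
      qed
    qed
  qed
  moreover obtain m where "\<alpha> < real m" using reals_Archimedean2 by blast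
  ultimately show ?thesis using assms by blast
qed

section \<open>Polynomial and Hoelder continuous densities\<close>

lemma powr_weight_shift:
  "t \<ge> 0 \<Longrightarrow> t * laguerre_weight \<alpha> t = laguerre_weight (\<alpha> + 1) t"
  using powr_mult_base[of t \<alpha>] by (simp add: laguerre_weight_def add.commute)

text \<open>Horner scheme: a factor \<open>t\<close> is absorbed by raising \<alpha> by 1, which is
  why \<alpha> varies in the induction.\<close>

lemma set_integrable_poly_weight:
  assumes "\<alpha> > -1"
  shows "set_integrable lborel {0..} (\<lambda>t. poly q t * laguerre_weight \<alpha> t)"
  using assms
proof (induction q arbitrary: \<alpha>)
  case 0
  then show ?case by (simp add: set_integrable_def)
next
  case (pCons a q)
  have "set_integrable lborel {0..} (\<lambda>t. a * (t powr \<alpha> * exp (- t)) + poly q t * laguerre_weight (\<alpha> + 1) t)"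
    using pCons.prems by (intro set_integral_add set_integrable_mult_right set_integrable_Gamma pCons.IH) auto
  also have "?this \<longleftrightarrow> ?case"
  proof (intro set_integrable_cong refl)
    fix t :: real assume "t \<in> {0..}"
    then have "laguerre_weight (\<alpha> + 1) t = t * laguerre_weight \<alpha> t"
      using powr_weight_shift[of t \<alpha>] by simp
    then show "a * (t powr \<alpha> * exp (- t)) + poly q t * laguerre_weight (\<alpha> + 1) t
        = poly (pCons a q) t * laguerre_weight \<alpha> t"
      unfolding laguerre_weight_def[of \<alpha>, symmetric] by (simp add: algebra_simps)
  qed
  finally show ?case .
qed

text \<open>From t = x + (t - x): multiplication by \<open>t\<close> is multiplication by
  \<open>x\<close> up to a term without singularity.\<close>

lemma kernel_split: "t \<noteq> x \<Longrightarrow> t * c / (t - x) = x * c / (t - x) + (c::real)"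
  by (simp add: field_simps)

lemma continuous_on_laguerre_Q_0: "continuous_on {0<..} (laguerre_Q 0 \<alpha>)"
proof -
  have "continuous_on S (confluent_hyp a c)" for S a c
    using has_real_derivative_confluent_hyp
    by (metis DERIV_isCont continuous_at_imp_continuous_on)
  from continuous_on_compose2[OF this continuous_on_id] show ?thesis
    unfolding laguerre_Q_def laguerre_0 by (intro continuous_intros) auto
qed

text \<open>Horner scheme with \<open>kernel_split\<close>: the regular part contributes a constant
  \<open>c\<close> independent of \<open>x\<close>. The values are delivered as one continuous
  function because the confluent case at a node is obtained by a limit.\<close>

lemma has_pv_poly_weight:
  assumes "\<alpha> > -1" "\<alpha> \<notin> \<nat>"
  obtains V where "continuous_on {0<..} V"
    "\<And>x. x > 0 \<Longrightarrow> has_pv (\<lambda>t. poly q t * laguerre_weight \<alpha> t / (t - x)) x (V x)"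
proof -
  have "\<exists>V. continuous_on {0<..} V \<and>
    (\<forall>x>0. has_pv (\<lambda>t. poly q t * laguerre_weight \<alpha> t / (t - x)) x (V x))"
  proof (induction q)
    case 0
    show ?case by (rule exI[of _ "\<lambda>_. 0"]) (auto intro: has_pv_0)
  next
    case (pCons a q)
    then obtain V where V: "continuous_on {0<..} V"
      "\<And>x. x > 0 \<Longrightarrow> has_pv (\<lambda>t. poly q t * laguerre_weight \<alpha> t / (t - x)) x (V x)" by blast
    define c where "c = (LINT t:{0..}|lborel. poly q t * laguerre_weight \<alpha> t)"
    show ?case
    proof (intro exI[of _ "\<lambda>x. a * (pi * laguerre_Q 0 \<alpha> x) + (x * V x + c)"] conjI allI impI)
      show "continuous_on {0<..} (\<lambda>x. a * (pi * laguerre_Q 0 \<alpha> x) + (x * V x + c))"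
        by (intro continuous_intros V continuous_on_laguerre_Q_0)
      fix x :: real assume x: "x > 0"
      have "has_pv (\<lambda>t. a * (laguerre_weight \<alpha> t / (t - x)) + (x * (poly q t * laguerre_weight \<alpha> t / (t - x))
          + poly q t * laguerre_weight \<alpha> t)) x (a * (pi * laguerre_Q 0 \<alpha> x) + (x * V x + c))"
        unfolding c_def
        by (intro has_pv_add has_pv_cmult has_pv_laguerre_weight assms x V(2) has_pv_integrable set_integrable_poly_weight)
      then show "has_pv (\<lambda>t. poly (pCons a q) t * laguerre_weight \<alpha> t / (t - x)) x
          (a * (pi * laguerre_Q 0 \<alpha> x) + (x * V x + c))"
        by (rule has_pv_cong[OF _ x])
          (simp add: kernel_split[of _ x] distrib_right add_divide_distrib mult.assoc)
    qed
  qed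
  with that show ?thesis by blast
qed

section \<open>Laguerre densities\<close>

definition laguerre_poly :: "nat \<Rightarrow> real \<Rightarrow> real poly" where
  "laguerre_poly n \<alpha> = (\<Sum>k=0..n. monom (((real n + \<alpha>) gchoose (n - k)) * (- 1) ^ k / fact k) k)"

lemma poly_laguerre_poly [simp]: "poly (laguerre_poly n \<alpha>) x = laguerre n \<alpha> x"
  by (simp add: laguerre_poly_def laguerre_def poly_sum poly_monom mult.assoc)

lemma degree_laguerre_poly [simp]: "degree (laguerre_poly n \<alpha>) = n"
proof (rule antisym)
  show "degree (laguerre_poly n \<alpha>) \<le> n"
    unfolding laguerre_poly_def
    by (intro degree_sum_le) (auto intro: order_trans[OF degree_monom_le])
  have "coeff (laguerre_poly n \<alpha>) n = (- 1) ^ n / fact n"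
    by (simp add: laguerre_poly_def coeff_sum)
  then show "n \<le> degree (laguerre_poly n \<alpha>)"
    by (intro le_degree) simp
qed

text \<open>The k-th moment of the weight is \<open>Gamma (\<alpha> + k + 1)\<close> and cancels the
  Gamma factor in the k-th coefficient. What remains is an alternating sum of binomial
  coefficients.\<close>

lemma laguerre_integral_zero:
  assumes "\<alpha> > -1" "n \<ge> 1"
  shows "(LINT t:{0..}|lborel. laguerre n \<alpha> t * laguerre_weight \<alpha> t) = 0"
proof -
  define c where "c k = ((real n + \<alpha>) gchoose (n - k)) * (- 1) ^ k / fact k" for k
  define g where "g k t = indicat_real {0..} t * (t powr (\<alpha> + real k) * exp (- t))" for k t
  have mom: "integrable lborel (g k)" "integral\<^sup>L lborel (g k) = Gamma (\<alpha> + real k + 1)" for k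
    using set_integrable_Gamma[of "\<alpha> + real k"] assms
    unfolding g_def set_integrable_def set_lebesgue_integral_def by auto
  have "(LINT t:{0..}|lborel. laguerre n \<alpha> t * laguerre_weight \<alpha> t)
      = (LINT t:{0..}|lborel. (\<Sum>k=0..n. c k * (t powr (\<alpha> + real k) * exp (- t))))"
  proof (rule set_lebesgue_integral_cong; (intro allI impI)?)
    fix t :: real assume t: "t \<in> {0..}"
    \<comment> \<open>At t = 0 both sides are 0, since \<open>0 powr s = 0\<close> for every
      s.\<close>
    have "t ^ k * t powr \<alpha> = t powr (\<alpha> + real k)" for k
      using t by (cases "t = 0") (auto simp: powr_add powr_realpow)
    then show "laguerre n \<alpha> t * laguerre_weight \<alpha> t = (\<Sum>k=0..n. c k * (t powr (\<alpha> + real k) * exp (- t)))"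
      unfolding laguerre_def laguerre_weight_def c_def sum_distrib_right
      by (intro sum.cong refl) (simp add: mult_ac)
  qed simp
  also have "\<dots> = (\<Sum>k=0..n. c k * Gamma (\<alpha> + real k + 1))"
  proof -
    have "(LINT t:{0..}|lborel. (\<Sum>k=0..n. c k * (t powr (\<alpha> + real k) * exp (- t))))
        = (\<integral>t. (\<Sum>k=0..n. c k * g k t) \<partial>lborel)"
      unfolding set_lebesgue_integral_def real_scaleR_def g_def sum_distrib_left
      by (simp only: mult.left_commute)
    then show ?thesis by (simp add: mom)
  qed
  also have "\<dots> = (\<Sum>k=0..n. Gamma (\<alpha> + real n + 1) / fact n * ((- 1) ^ k * real (n choose k)))"
  proof (rule sum.cong[OF refl])
    fix k assume "k \<in> {0..n}"
    then have k: "k \<le> n" by simp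
    have np: "\<alpha> + real k + 1 \<notin> \<int>\<^sub>\<le>\<^sub>0" using assms(1) by (auto elim!: nonpos_Ints_cases')
    have "pochhammer (\<alpha> + real k + 1) (n - k) = Gamma (\<alpha> + real n + 1) / Gamma (\<alpha> + real k + 1)"
      using pochhammer_Gamma[OF np, of "n - k"] k by (simp add: of_nat_diff algebra_simps)
    moreover have "(real n + \<alpha>) gchoose (n - k) = pochhammer (\<alpha> + real k + 1) (n - k) / fact (n - k)"
      using k by (simp add: gbinomial_pochhammer' of_nat_diff algebra_simps)
    moreover have "Gamma (\<alpha> + real k + 1) \<noteq> 0"
      using np by (simp add: Gamma_eq_zero_iff)
    ultimately show "c k * Gamma (\<alpha> + real k + 1) = Gamma (\<alpha> + real n + 1) / fact n * ((- 1) ^ k * real (n choose k))"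
      using k by (simp add: c_def binomial_fact)
  qed
  also have "\<dots> = 0"
    using choose_alternating_sum[of n, where ?'a = real] assms(2)
    unfolding sum_distrib_left[symmetric] by (simp add: atLeast0AtMost)
  finally show ?thesis .
qed

text \<open>Both sides satisfy the three-term recurrence of the Laguerre polynomials: for the integrals
  the difference between multiplication by \<open>t\<close> and by \<open>x\<close> vanishes by orthogonality to constants.\<close>
lemma has_pv_laguerre:
  assumes "\<alpha> > -1" "\<alpha> \<notin> \<nat>" "x > 0"
  shows "has_pv (\<lambda>t. laguerre n \<alpha> t * laguerre_weight \<alpha> t / (t - x)) x (pi * laguerre_Q n \<alpha> x)"
proof (induction n rule: induct_nat_012)
  case 0
  then show ?case using has_pv_laguerre_weight[OF assms] by simp
next
  case 1
  \<comment> \<open>Here the regular term is the weight itself, whose integral is not 0; it matches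
    the inhomogeneous term of \<open>laguerre_Q_1\<close>.\<close>
  have "has_pv (\<lambda>t. (1 + \<alpha> - x) * (laguerre_weight \<alpha> t / (t - x)) - t powr \<alpha> * exp (- t)) x
      ((1 + \<alpha> - x) * (pi * laguerre_Q 0 \<alpha> x) - Gamma (\<alpha> + 1))"
    unfolding set_integrable_Gamma(2)[OF assms(1), symmetric]
    by (intro has_pv_diff has_pv_cmult has_pv_laguerre_weight has_pv_integrable set_integrable_Gamma assms)
  also have "(1 + \<alpha> - x) * (pi * laguerre_Q 0 \<alpha> x) - Gamma (\<alpha> + 1) = pi * laguerre_Q (Suc 0) \<alpha> x"
    unfolding laguerre_Q_1[OF assms(1,2)] by (simp add: algebra_simps)
  finally show ?case
    by (rule has_pv_cong[OF _ assms(3)]) (auto simp: laguerre_1 laguerre_weight_def field_simps)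
next
  case (ge2 n)
  let ?w = "laguerre_weight \<alpha>"
  have int: "set_integrable lborel {0..} (\<lambda>t. laguerre (n + 1) \<alpha> t * ?w t)"
    using set_integrable_poly_weight[OF assms(1), of "laguerre_poly (n + 1) \<alpha>"] by simp
  have ih: "has_pv (\<lambda>t. laguerre n \<alpha> t * ?w t / (t - x)) x (pi * laguerre_Q n \<alpha> x)"
    "has_pv (\<lambda>t. laguerre (n + 1) \<alpha> t * ?w t / (t - x)) x (pi * laguerre_Q (n + 1) \<alpha> x)"
    using ge2 by simp_all
  have 0: "has_pv (\<lambda>t. laguerre (n + 1) \<alpha> t * ?w t) x 0"
    using has_pv_integrable[OF int assms(3)] laguerre_integral_zero[OF assms(1), of "n + 1"] by simp
  let ?A = "real (2 * n + 3) + \<alpha>" and ?B = "real (n + 1) + \<alpha>"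
  have "has_pv (\<lambda>t. 1 / real (n + 2) * ((?A - x) * (laguerre (n + 1) \<alpha> t * ?w t / (t - x))
        - ?B * (laguerre n \<alpha> t * ?w t / (t - x)) - laguerre (n + 1) \<alpha> t * ?w t)) x
      (1 / real (n + 2) * ((?A - x) * (pi * laguerre_Q (n + 1) \<alpha> x) - ?B * (pi * laguerre_Q n \<alpha> x) - 0))"
    by (intro has_pv_cmult has_pv_diff ih 0)
  also have "(?A - x) * (pi * laguerre_Q (n + 1) \<alpha> x) - ?B * (pi * laguerre_Q n \<alpha> x) - 0
      = real (n + 2) * (pi * laguerre_Q (n + 2) \<alpha> x)"
    using arg_cong[OF laguerre_Q_recurrence[OF assms(1,2), of n x], of "\<lambda>u. pi * u"] by (simp only: right_diff_distrib mult.left_commute)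
  also have "1 / real (n + 2) * (real (n + 2) * (pi * laguerre_Q (n + 2) \<alpha> x)) = pi * laguerre_Q (Suc (Suc n)) \<alpha> x"
    by (simp del: of_nat_add of_nat_Suc)
  finally show ?case
  proof (rule has_pv_cong[OF _ assms(3)])
    fix t :: real assume "t \<ge> 0" "t \<noteq> x"
    define L0 L1 where "L0 = laguerre n \<alpha> t" and "L1 = laguerre (n + 1) \<alpha> t"
    have L2: "laguerre (Suc (Suc n)) \<alpha> t = 1 / real (n + 2) * ((?A - t) * L1 - ?B * L0)"
      using laguerre_recurrence[OF assms(1), of n t] unfolding L0_def L1_def
      by (simp add: field_simps del: of_nat_Suc of_nat_add)
    have "(?A - x) * (L1 * ?w t / (t - x)) - ?B * (L0 * ?w t / (t - x)) - L1 * ?w t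
        = ((?A - t) * L1 - ?B * L0) * ?w t / (t - x)"
    proof -
      define u where "u = ?w t / (t - x)"
      have w: "?w t = (t - x) * u" and e: "c * ((t - x) * u) / (t - x) = c * u" for c
        using \<open>t \<noteq> x\<close> by (simp_all add: u_def)
      show ?thesis unfolding w e by (simp add: algebra_simps)
    qed
    then show "1 / real (n + 2) * ((?A - x) * (laguerre (n + 1) \<alpha> t * ?w t / (t - x))
        - ?B * (laguerre n \<alpha> t * ?w t / (t - x)) - laguerre (n + 1) \<alpha> t * ?w t)
      = laguerre (Suc (Suc n)) \<alpha> t * ?w t / (t - x)"
      unfolding L2 L0_def[symmetric] L1_def[symmetric] by (simp only: times_divide_eq_right mult.assoc)
  qed
qed

section \<open>Hoelder continuous densities of exponential growth\<close>

lemma holder_imp_continuous_on: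
  assumes "\<And>a. a > 0 \<Longrightarrow> holder_continuous_on {0..a} f"
  shows "continuous_on {0..} f"
  unfolding continuous_on_def
proof
  fix x :: real assume x: "x \<in> {0..}"
  have "holder_continuous_on {0..x + 1} f" using x by (intro assms) simp
  then obtain \<mu> A where \<mu>: "0 < \<mu>"
    "\<forall>s\<in>{0..x + 1}. \<forall>t\<in>{0..x + 1}. \<bar>f s - f t\<bar> \<le> A * \<bar>s - t\<bar> powr \<mu>"
    unfolding holder_continuous_on_def by blast
  have "((\<lambda>t. f t - f x) \<longlongrightarrow> 0) (at x within {0..})"
  proof (rule Lim_null_comparison)
    have "\<forall>\<^sub>F t in at x within {0..}. t < x + 1"
      by (rule order_tendstoD(2)[OF tendsto_ident_at]) simp
    moreover have "\<forall>\<^sub>F t in at x within {0..}. t \<in> {0..}"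
      by (simp add: eventually_at_filter)
    ultimately show "\<forall>\<^sub>F t in at x within {0..}. norm (f t - f x) \<le> A * \<bar>t - x\<bar> powr \<mu>"
      by eventually_elim (use \<mu>(2) x in auto)
    have "((\<lambda>t. A * \<bar>t - x\<bar> powr \<mu>) \<longlongrightarrow> A * \<bar>x - x\<bar> powr \<mu>) (at x within {0..})"
      using \<mu>(1) by (intro tendsto_intros) auto
    then show "((\<lambda>t. A * \<bar>t - x\<bar> powr \<mu>) \<longlongrightarrow> 0) (at x within {0..})" by simp
  qed
  then show "(f \<longlongrightarrow> f x) (at x within {0..})" by (rule LIM_zero_cancel)
qed

text \<open>Compactness bounds \<open>f\<close> on the initial segment. Replacing \<beta> by b = max
  \<beta> 0 makes the exponential at least 1, so that one constant covers both ranges.\<close>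

lemma exponential_growth_bound:
  fixes f :: "real \<Rightarrow> real"
  assumes "continuous_on {0..} f" "\<forall>\<^sub>F x in at_top. \<bar>f x\<bar> \<le> C * exp (\<beta> * x)" "\<beta> < 1"
  shows "\<exists>K b. 0 \<le> b \<and> b < 1 \<and> (\<forall>t\<ge>0. \<bar>f t\<bar> \<le> K * exp (b * t))"
proof -
  obtain N where N: "\<And>x. x \<ge> N \<Longrightarrow> \<bar>f x\<bar> \<le> C * exp (\<beta> * x)"
    using assms(2) by (auto simp: eventually_at_top_linorder)
  have "compact (f ` {0..max N 0})"
    by (intro compact_continuous_image continuous_on_subset[OF assms(1)]) auto
  then have "bounded (f ` {0..max N 0})" by (rule compact_imp_bounded)
  then obtain B where B: "\<forall>t\<in>{0..max N 0}. \<bar>f t\<bar> \<le> B"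
    unfolding bounded_iff by auto
  define b where "b = max \<beta> 0"
  define K where "K = max \<bar>C\<bar> \<bar>B\<bar>"
  have b: "0 \<le> b" "b < 1" "\<beta> \<le> b" using assms(3) by (auto simp: b_def)
  have "\<bar>f t\<bar> \<le> K * exp (b * t)" if t: "t \<ge> 0" for t
  proof (cases "t \<ge> N")
    case True
    have "\<bar>f t\<bar> \<le> C * exp (\<beta> * t)" by (rule N[OF True])
    also have "\<dots> \<le> K * exp (b * t)"
      using b t by (intro mult_mono) (auto simp: K_def intro: mult_right_mono)
    finally show ?thesis .
  next
    case False
    have "\<bar>f t\<bar> \<le> K * 1" using bspec[OF B, of t] t False by (auto simp: K_def)
    also have "\<dots> \<le> K * exp (b * t)" using b t by (intro mult_left_mono) (auto simp: K_def)
    finally show ?thesis .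
  qed
  with b show ?thesis by blast
qed

lemma set_integrable_abs_powr:
  fixes c r s :: real
  assumes "s > -1" "r \<ge> 0"
  shows "set_integrable lborel {c - r..c + r} (\<lambda>t. \<bar>t - c\<bar> powr s)"
proof -
  define h where "h u = indicat_real {0..r} u * u powr s" for u
  have "set_integrable lborel {0..r} (\<lambda>u. u powr s)"
    by (rule set_integrable_has_integral_nonneg(1)[OF _ _ _ has_integral_powr_from_0]) (use assms in auto)
  then have h: "integrable lborel h"
    by (simp add: h_def[abs_def] set_integrable_def)
  have "integrable lborel (\<lambda>t. h (- c + 1 * t) + h (c + (- 1) * t))"
    by (intro Bochner_Integration.integrable_add lborel_integrable_real_affine h) auto
  \<comment> \<open>Two mirrored copies of \<open>h\<close>; at t = c both are 0 because
    \<open>0 powr s = 0\<close>.\<close>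
  moreover have "indicat_real {c - r..c + r} t *\<^sub>R \<bar>t - c\<bar> powr s = h (- c + 1 * t) + h (c + (- 1) * t)" for t
    by (cases "t < c"; cases "t > c") (auto simp: h_def indicator_def)
  ultimately show ?thesis by (simp add: set_integrable_def)
qed

text \<open>Subtracting \<open>f x\<close> makes the singularity at \<open>x\<close> integrable by Hoelder continuity.\<close>
lemma has_pv_holder:
  assumes "\<alpha> > -1" "\<alpha> \<notin> \<nat>" "x > 0"
    and holder: "\<And>a. a > 0 \<Longrightarrow> holder_continuous_on {0..a} f"
    and growth: "\<forall>\<^sub>F x in at_top. \<bar>f x\<bar> \<le> C * exp (\<beta> * x)" "\<beta> < 1"
  obtains L where "has_pv (\<lambda>t. f t * laguerre_weight \<alpha> t / (t - x)) x L"
proof -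
  have cont: "continuous_on {0..} f"
    by (rule holder_imp_continuous_on) (rule holder)
  obtain K b where K: "0 \<le> b" "b < 1" "\<forall>t\<ge>0. \<bar>f t\<bar> \<le> K * exp (b * t)"
    using exponential_growth_bound[OF cont growth] by blast
  \<comment> \<open>Nothing is known about \<open>f\<close> on the negative axis; cutting it off
    there yields a Borel function.\<close>
  define F where "F t = indicat_real {0..} t * f t" for t
  have Fm: "F \<in> borel_measurable borel"
    using borel_measurable_continuous_on_indicator[OF _ cont] by (simp add: F_def[abs_def])
  have wm: "laguerre_weight \<alpha> \<in> borel_measurable borel"
    unfolding laguerre_weight_def[abs_def] by simp
  have F: "F t = f t" if "t \<ge> 0" for t using that by (simp add: F_def)
  have w0: "laguerre_weight \<alpha> t \<ge> 0" for t by (simp add: laguerre_weight_def)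
  define g where "g t = (F t - F x) * laguerre_weight \<alpha> t / (t - x)" for t
  have [measurable]: "g \<in> borel_measurable borel"
  proof -
    have "(\<lambda>t. (F t - F x) * laguerre_weight \<alpha> t / (t - x)) \<in> borel_measurable borel"
      by (intro borel_measurable_divide borel_measurable_times borel_measurable_diff borel_measurable_const
        measurable_ident_sets Fm wm) simp
    then show ?thesis by (simp add: g_def[abs_def])
  qed
  have meas: "set_borel_measurable lborel S g" if "S \<in> sets borel" for S
  proof -
    note that[measurable]
    show ?thesis unfolding set_borel_measurable_def by simp
  qed
  have K0: "K \<ge> 0" using K(3)[rule_format, of 0] by simp
  have bound: "\<bar>F t - F x\<bar> \<le> (K + \<bar>F x\<bar>) * exp (b * t)" if "t \<ge> 0" for t
  proof -
    have "\<bar>F x\<bar> * 1 \<le> \<bar>F x\<bar> * exp (b * t)"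
      using K(1) that by (intro mult_left_mono) auto
    then show ?thesis using K(3)[rule_format, OF that] F[OF that] by (simp add: algebra_simps)
  qed
  \<comment> \<open>Away from \<open>x\<close> the denominator is at least x / 2, and growth e^(b t)
    against the weight leaves the decay e^(-(1 - b) t).\<close>
  have far: "set_integrable lborel S g" if S: "S \<subseteq> {0..}" "S \<in> sets borel" "\<And>t. t \<in> S \<Longrightarrow> \<bar>t - x\<bar> \<ge> x / 2" for S
  proof (rule set_integrable_bound[OF _ meas[OF S(2)]])
    have "set_integrable lborel {0..} (\<lambda>t. 2 / x * (K + \<bar>F x\<bar>) * (t powr \<alpha> * exp (- ((1 - b) * t))))"
      using K(2) assms(1) by (intro set_integrable_mult_right set_integrable_Gamma_scaled) auto
    then show "set_integrable lborel S (\<lambda>t. 2 / x * (K + \<bar>F x\<bar>) * (t powr \<alpha> * exp (- ((1 - b) * t))))"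
      by (rule set_integrable_subset) (use S in auto)
    have "norm (g t) \<le> norm (2 / x * (K + \<bar>F x\<bar>) * (t powr \<alpha> * exp (- ((1 - b) * t))))" if t: "t \<in> S" for t
    proof -
      have t0: "t \<ge> 0" using t S by auto
      have d: "\<bar>t - x\<bar> \<ge> x / 2" by (rule S(3)[OF t])
      have "norm (g t) = \<bar>F t - F x\<bar> * laguerre_weight \<alpha> t / \<bar>t - x\<bar>"
        using w0 by (simp add: g_def abs_mult)
      also have "\<dots> \<le> ((K + \<bar>F x\<bar>) * exp (b * t)) * laguerre_weight \<alpha> t / (x / 2)"
        using bound[OF t0] w0[of t] d assms(3) K0
        by (intro frac_le mult_right_mono mult_nonneg_nonneg) auto
      also have "\<dots> = 2 / x * (K + \<bar>F x\<bar>) * (t powr \<alpha> * (exp (b * t) * exp (- t)))"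
        by (simp add: laguerre_weight_def mult_ac)
      also have "exp (b * t) * exp (- t) = exp (- ((1 - b) * t))"
        by (simp add: mult_exp_exp algebra_simps)
      finally show ?thesis by (rule order_trans) (simp only: real_norm_def abs_ge_self)
    qed
    then show "AE t in lborel. t \<in> S \<longrightarrow> norm (g t) \<le> norm (2 / x * (K + \<bar>F x\<bar>) * (t powr \<alpha> * exp (- ((1 - b) * t))))"
      by simp
  qed
  have "holder_continuous_on {0..2 * x} f" using assms(3) by (intro holder) simp
  then obtain \<mu> A where \<mu>: "0 < \<mu>"
    "\<forall>s\<in>{0..2 * x}. \<forall>t\<in>{0..2 * x}. \<bar>f s - f t\<bar> \<le> A * \<bar>s - t\<bar> powr \<mu>"
    unfolding holder_continuous_on_def by blast
  \<comment> \<open>This neighbourhood keeps away from 0, where the weight is unbounded if \<alpha>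
    < 0. On it the integrand is dominated by a power of the distance with exponent \<mu> - 1 >
    -1.\<close>
  let ?N = "{x - x / 2..x + x / 2}"
  have "compact (laguerre_weight \<alpha> ` ?N)"
    unfolding laguerre_weight_def[abs_def] using assms(3)
    by (intro compact_continuous_image continuous_intros) auto
  then obtain W where W: "\<And>t. t \<in> ?N \<Longrightarrow> laguerre_weight \<alpha> t \<le> W"
    using compact_imp_bounded[of "laguerre_weight \<alpha> ` ?N"] unfolding bounded_iff
    by (metis abs_le_D1 image_eqI real_norm_def)
  have near: "set_integrable lborel ?N g"
  proof (rule set_integrable_bound[OF _ meas])
    show "set_integrable lborel ?N (\<lambda>t. A * W * \<bar>t - x\<bar> powr (\<mu> - 1))"
      using \<mu>(1) assms(3) by (intro set_integrable_mult_right set_integrable_abs_powr) auto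
    have "norm (g t) \<le> norm (A * W * \<bar>t - x\<bar> powr (\<mu> - 1))" if t: "t \<in> ?N" for t
    proof (cases "t = x")
      case True
      then show ?thesis by (simp add: g_def)
    next
      case False
      then have p: "\<bar>t - x\<bar> powr \<mu> / \<bar>t - x\<bar> = \<bar>t - x\<bar> powr (\<mu> - 1)" by (simp add: powr_diff)
      have t0: "0 \<le> t" "t \<le> 2 * x" using t assms(3) by auto
      have h: "\<bar>F t - F x\<bar> \<le> A * \<bar>t - x\<bar> powr \<mu>"
        using \<mu>(2) t0 assms(3) by (simp add: F)
      have "norm (g t) = \<bar>F t - F x\<bar> * laguerre_weight \<alpha> t / \<bar>t - x\<bar>"
        using w0 by (simp add: g_def abs_mult)
      also have "\<dots> \<le> (A * \<bar>t - x\<bar> powr \<mu>) * W / \<bar>t - x\<bar>"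
        using h W[OF t] w0[of t] by (intro divide_right_mono mult_mono) auto
      also have "\<dots> = A * W * (\<bar>t - x\<bar> powr \<mu> / \<bar>t - x\<bar>)" by simp
      also have "\<dots> \<le> norm (A * W * \<bar>t - x\<bar> powr (\<mu> - 1))" unfolding p by simp
      finally show ?thesis .
    qed
    then show "AE t in lborel. t \<in> ?N \<longrightarrow> norm (g t) \<le> norm (A * W * \<bar>t - x\<bar> powr (\<mu> - 1))" by simp
  qed simp
  have un: "{0..} = ?N \<union> ({0..} - ?N)" using assms(3) by auto
  have "set_integrable lborel {0..} g"
    by (subst un, rule set_integrable_Un[OF near far]) (use assms(3) in auto)
  from has_pv_add[OF has_pv_cmult[OF has_pv_laguerre_weight[OF assms(1-3)], of "F x"] has_pv_integrable[OF this assms(3)]]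
  have "has_pv (\<lambda>t. F x * (laguerre_weight \<alpha> t / (t - x)) + g t) x
      (F x * (pi * laguerre_Q 0 \<alpha> x) + (LINT t:{0..}|lborel. g t))" .
  then have "has_pv (\<lambda>t. f t * laguerre_weight \<alpha> t / (t - x)) x
      (F x * (pi * laguerre_Q 0 \<alpha> x) + (LINT t:{0..}|lborel. g t))"
    by (rule has_pv_cong[OF _ assms(3)])
      (simp add: g_def F left_diff_distrib diff_divide_distrib)
  with that show ?thesis by blast
qed

text \<open>If \<open>V\<close> denotes the principal value for the cofactor \<open>l\<close>, then \<open>pi * Q y - (y - u) * V y\<close> does not
  depend on \<open>y\<close>; comparison with \<open>y = u\<close> gives the divided difference, and continuity of \<open>V\<close> its
  confluent case.\<close>
lemma has_pv_laguerre_cofactor: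
  assumes "\<alpha> > -1" "\<alpha> \<notin> \<nat>" "laguerre n \<alpha> u = 0" "u > 0" "x > 0"
    and l: "laguerre_poly n \<alpha> = [:- u, 1:] * l"
    and D: "(laguerre_Q n \<alpha> has_real_derivative D) (at u)"
  shows "has_pv (\<lambda>t. poly l t * laguerre_weight \<alpha> t / (t - x)) x
    (pi * (if x = u then D else (laguerre_Q n \<alpha> x - laguerre_Q n \<alpha> u) / (x - u)))"
proof -
  let ?Q = "laguerre_Q n \<alpha>" and ?w = "laguerre_weight \<alpha>"
  obtain V where V: "continuous_on {0<..} V"
    "\<And>x. x > 0 \<Longrightarrow> has_pv (\<lambda>t. poly l t * ?w t / (t - x)) x (V x)"
    using has_pv_poly_weight[OF assms(1,2), of l] by blast
  define c where "c = (LINT t:{0..}|lborel. poly l t * ?w t)"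
  have L: "laguerre n \<alpha> t = (t - u) * poly l t" for t
    using arg_cong[OF l, of "\<lambda>p. poly p t"] by (simp add: algebra_simps)
  have eq: "pi * ?Q y = (y - u) * V y + c" if y: "y > 0" for y
  proof -
    have "has_pv (\<lambda>t. (y - u) * (poly l t * ?w t / (t - y)) + poly l t * ?w t) y ((y - u) * V y + c)"
      unfolding c_def by (intro has_pv_add has_pv_cmult V y has_pv_integrable set_integrable_poly_weight assms(1))
    then have "has_pv (\<lambda>t. laguerre n \<alpha> t * ?w t / (t - y)) y ((y - u) * V y + c)"
      by (rule has_pv_cong[OF _ y])
        (simp add: L kernel_split[of _ y] left_diff_distrib diff_divide_distrib mult.assoc)
    with has_pv_laguerre[OF assms(1,2) y] show ?thesis by (rule has_pv_unique)
  qed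
  have V_eq: "V y = pi * ((?Q y - ?Q u) / (y - u))" if "y > 0" "y \<noteq> u" for y
    using eq[OF that(1)] eq[OF assms(4)] that by (simp add: field_simps)
  have "V u = pi * D"
  proof (rule tendsto_unique)
    have "isCont V u"
      using V(1) assms(4) by (simp add: continuous_on_eq_continuous_at)
    then show "(V \<longlongrightarrow> V u) (at u)" by (simp add: isCont_def)
    have "((\<lambda>y. pi * ((?Q y - ?Q u) / (y - u))) \<longlongrightarrow> pi * D) (at u)"
      using D by (intro tendsto_mult_left) (simp add: has_field_derivative_iff)
    moreover have "\<forall>\<^sub>F y in at u. y > 0"
      using order_tendstoD(1)[OF tendsto_ident_at assms(4)] by simp
    then have "\<forall>\<^sub>F y in at u. pi * ((?Q y - ?Q u) / (y - u)) = V y"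
      using eventually_neq_at_within[of u u] by eventually_elim (simp add: V_eq)
    ultimately show "(V \<longlongrightarrow> pi * D) (at u)" by (rule Lim_transform_eventually)
  qed simp
  then show ?thesis using V(2)[OF assms(5)] V_eq[OF assms(5)] by (cases "x = u") auto
qed

section \<open>Interpolation at the zeros\<close>

locale laguerre_nodes =
  fixes n :: nat and \<alpha> :: real and z :: "nat \<Rightarrow> real"
  assumes n: "n \<ge> 1"
    and alpha: "\<alpha> > -1" "\<alpha> \<notin> \<nat>"
    and zeros: "bij_betw z {1..n} {x. laguerre n \<alpha> x = 0}"
begin

lemma node_zero: "m \<in> {1..n} \<Longrightarrow> laguerre n \<alpha> (z m) = 0"
  using bij_betwE[OF zeros] by blast

lemma node_pos: "m \<in> {1..n} \<Longrightarrow> z m > 0"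
  using node_zero[of m] laguerre_pos_nonpos[OF alpha(1), of "z m" n] by force

lemma node_inj: "i \<in> {1..n} \<Longrightarrow> m \<in> {1..n} \<Longrightarrow> z i = z m \<longleftrightarrow> i = m"
  using bij_betw_imp_inj_on[OF zeros] by (auto dest: inj_onD)

text \<open>Up to normalisation, the Lagrange basis polynomial of the node
  \<open>z m\<close>.\<close>

definition cofactor :: "nat \<Rightarrow> real poly" where
  "cofactor m = laguerre_poly n \<alpha> div [:- z m, 1:]"

lemma cofactor:
  assumes "m \<in> {1..n}"
  shows "laguerre_poly n \<alpha> = [:- z m, 1:] * cofactor m"
  using node_zero[OF assms] by (simp add: cofactor_def poly_eq_0_iff_dvd[symmetric] del: mult_pCons_left)

lemma degree_cofactor:
  assumes "m \<in> {1..n}"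
  shows "degree (cofactor m) = n - 1"
proof -
  have "cofactor m \<noteq> 0"
  proof
    assume "cofactor m = 0"
    then have "laguerre_poly n \<alpha> = 0" using cofactor[OF assms] by simp
    then have "n = 0" using degree_laguerre_poly[of n \<alpha>] by simp
    with n show False by simp
  qed
  then have "degree ([:- z m, 1:] * cofactor m) = Suc (degree (cofactor m))"
    by (subst degree_mult_eq) auto
  then show ?thesis using cofactor[OF assms] degree_laguerre_poly[of n \<alpha>] by simp
qed

lemma poly_cofactor_other:
  assumes "m \<in> {1..n}" "i \<in> {1..n}" "i \<noteq> m"
  shows "poly (cofactor m) (z i) = 0"
proof -
  have "(z i - z m) * poly (cofactor m) (z i) = 0"
    using arg_cong[OF cofactor[OF assms(1)], of "\<lambda>p. poly p (z i)"] node_zero[OF assms(2)]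
    by (auto simp: algebra_simps)
  then show ?thesis using node_inj[OF assms(2,1)] assms(3) by simp
qed

text \<open>The zeros are simple, since the cofactor has degree \<open>n - 1\<close> and vanishes at the other nodes.\<close>
lemma poly_cofactor_self:
  assumes "m \<in> {1..n}"
  shows "poly (cofactor m) (z m) \<noteq> 0"
proof
  assume "poly (cofactor m) (z m) = 0"
  then have "poly (cofactor m) x = poly 0 x" if "x \<in> z ` {1..n}" for x
    using that poly_cofactor_other[OF assms] by (metis imageE poly_0)
  moreover have "card (z ` {1..n}) = n"
    using card_image[OF bij_betw_imp_inj_on[OF zeros]] by simp
  ultimately have "cofactor m = 0"
    using degree_cofactor[OF assms] n by (intro poly_eqI_degree[of "z ` {1..n}"]) auto
  then have "laguerre_poly n \<alpha> = 0" using cofactor[OF assms] by simp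
  then have "n = 0" using degree_laguerre_poly[of n \<alpha>] by simp
  with n show False by simp
qed

text \<open>Both sides are the reciprocal of the derivative of the Laguerre polynomial at the node,
  computed once from the factorization and once from \<open>has_real_derivative_laguerre\<close>. So
  the coefficients \<gamma> are exactly the normalising factors of the Lagrange basis.\<close>

lemma quad_weight_eq:
  assumes "m \<in> {1..n}"
  shows "quad_weight n \<alpha> (z m) = 1 / poly (cofactor m) (z m)"
proof -
  have "laguerre n \<alpha> = (\<lambda>x. (x - z m) * poly (cofactor m) x)"
    using arg_cong[OF cofactor[OF assms], of poly] by (simp add: fun_eq_iff algebra_simps)
  moreover have "((\<lambda>x. (x - z m) * poly (cofactor m) x) has_real_derivative
      poly (cofactor m) (z m)) (at (z m))"
    by (auto intro!: derivative_eq_intros)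
  ultimately have "(laguerre n \<alpha> has_real_derivative poly (cofactor m) (z m)) (at (z m))" by simp
  then have "poly (cofactor m) (z m) = - ((real n + \<alpha>) * laguerre (n - 1) \<alpha> (z m)) / z m"
    using has_real_derivative_laguerre[OF alpha(1) n node_pos[OF assms]] node_zero[OF assms]
    by (auto dest: DERIV_unique)
  then show ?thesis by (simp add: quad_weight_def)
qed

text \<open>Both polynomials have degree below n and agree at the n distinct nodes, where only the
  diagonal cofactor survives.\<close>

lemma lagrange_interpolation:
  assumes "degree p \<le> n - 1"
  shows "p = (\<Sum>m=1..n. smult (quad_weight n \<alpha> (z m) * poly p (z m)) (cofactor m))"
proof (rule poly_eqI_degree[of "z ` {1..n}"])
  have card: "card (z ` {1..n}) = n"
    using card_image[OF bij_betw_imp_inj_on[OF zeros]] by simp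
  show "degree p < card (z ` {1..n})" using assms n card by simp
  have "degree (\<Sum>m=1..n. smult (quad_weight n \<alpha> (z m) * poly p (z m)) (cofactor m)) \<le> n - 1"
    by (intro degree_sum_le) (auto intro: order_trans[OF degree_smult_le] simp: degree_cofactor)
  then show "degree (\<Sum>m=1..n. smult (quad_weight n \<alpha> (z m) * poly p (z m)) (cofactor m)) < card (z ` {1..n})"
    using n card by simp
  fix x assume "x \<in> z ` {1..n}"
  then obtain i where i: "i \<in> {1..n}" "x = z i" by blast
  have "poly (\<Sum>m=1..n. smult (quad_weight n \<alpha> (z m) * poly p (z m)) (cofactor m)) (z i)
      = (\<Sum>m=1..n. if m = i then poly p (z i) else 0)"
    unfolding poly_sum poly_smult
    by (intro sum.cong refl)
      (use i poly_cofactor_self[OF i(1)] in \<open>auto simp: poly_cofactor_other quad_weight_eq\<close>)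
  then show "poly p x = poly (\<Sum>m=1..n. smult (quad_weight n \<alpha> (z m) * poly p (z m)) (cofactor m)) x"
    using i by simp
qed

text \<open>Joins the two cases in which the remainder is defined, so that a single formula holds at
  nodes and elsewhere.\<close>

definition divided_diff_Q :: "nat \<Rightarrow> real \<Rightarrow> real" where
  "divided_diff_Q m x = (if x = z m then deriv (laguerre_Q n \<alpha>) (z m)
     else (laguerre_Q n \<alpha> x - laguerre_Q n \<alpha> (z m)) / (x - z m))"

lemma has_pv_poly:
  assumes "degree p \<le> n - 1" "x > 0"
  shows "has_pv (\<lambda>t. poly p t * laguerre_weight \<alpha> t / (t - x)) x
    (pi * (\<Sum>m=1..n. quad_weight n \<alpha> (z m) * poly p (z m) * divided_diff_Q m x))"
proof -
  define c where "c m = quad_weight n \<alpha> (z m) * poly p (z m)" for m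
  have "has_pv (\<lambda>t. \<Sum>m=1..n. c m * (poly (cofactor m) t * laguerre_weight \<alpha> t / (t - x))) x
      (\<Sum>m=1..n. c m * (pi * divided_diff_Q m x))"
  proof (intro has_pv_sum has_pv_cmult)
    fix m assume m: "m \<in> {1..n}"
    \<comment> \<open>The closed form of the derivative serves here to show that
      \<open>deriv\<close> is a true derivative and not a default value.\<close>
    have "(laguerre_Q n \<alpha> has_real_derivative deriv (laguerre_Q n \<alpha>) (z m)) (at (z m))"
      using has_real_derivative_laguerre_Q[OF alpha(1) n node_pos[OF m] node_zero[OF m]]
      by (metis DERIV_imp_deriv)
    from has_pv_laguerre_cofactor[OF alpha node_zero[OF m] node_pos[OF m] assms(2) cofactor[OF m] this]
    show "has_pv (\<lambda>t. poly (cofactor m) t * laguerre_weight \<alpha> t / (t - x)) x (pi * divided_diff_Q m x)"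
      unfolding divided_diff_Q_def .
  qed
  moreover have "poly p t = (\<Sum>m=1..n. c m * poly (cofactor m) t)" for t
    using arg_cong[OF lagrange_interpolation[OF assms(1)], of "\<lambda>q. poly q t"]
    by (simp add: poly_sum c_def)
  then have "(\<Sum>m=1..n. c m * (poly (cofactor m) t * laguerre_weight \<alpha> t / (t - x)))
      = poly p t * laguerre_weight \<alpha> t / (t - x)" for t
    by (simp add: sum_distrib_right sum_divide_distrib mult.assoc)
  moreover have "(\<Sum>m=1..n. c m * (pi * divided_diff_Q m x)) = pi * (\<Sum>m=1..n. c m * divided_diff_Q m x)"
    by (simp add: sum_distrib_left mult.left_commute)
  ultimately show ?thesis unfolding c_def by simp
qed

end

section \<open>The quadrature formula and its remainder\<close>

theorem theorem6p1:
  fixes n :: nat and \<alpha> :: real and f :: "real \<Rightarrow> real" and C \<beta> :: real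
    and z :: "nat \<Rightarrow> real" and R :: "real \<Rightarrow> real"
  assumes n: "n \<ge> 1"
    and alpha: "\<alpha> > -1" "\<alpha> \<notin> \<nat>"
    and holder: "\<And>a. a > 0 \<Longrightarrow> holder_continuous_on {0..a} f"
    and growth: "\<forall>\<^sub>F x in at_top. \<bar>f x\<bar> \<le> C * exp (\<beta> * x)" "\<beta> < 1"
    and zeros: "bij_betw z {1..n} {x. laguerre n \<alpha> x = 0}"
    and remainder: "\<And>x. 0 < x \<Longrightarrow> (\<forall>m\<in>{1..n}. x \<noteq> z m) \<Longrightarrow>
      singular_integral \<alpha> f x =
        (\<Sum>m=1..n. quad_weight n \<alpha> (z m) * f (z m) *
            ((laguerre_Q n \<alpha> x - laguerre_Q n \<alpha> (z m)) / (x - z m))) + R x"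
    and remainder_node: "\<And>j. j \<in> {1..n} \<Longrightarrow>
      singular_integral \<alpha> f (z j) =
        quad_weight n \<alpha> (z j) * f (z j) * deriv (laguerre_Q n \<alpha>) (z j)
        + (\<Sum>m\<in>{1..n} - {j}. quad_weight n \<alpha> (z m) * f (z m) *
            ((laguerre_Q n \<alpha> (z j) - laguerre_Q n \<alpha> (z m)) / (z j - z m))) + R (z j)"
  shows "(\<forall>j\<in>{1..n}.
      (laguerre_Q n \<alpha> has_real_derivative
        (1 / pi * exp (- z j) * Gamma \<alpha> *
           ((real n + \<alpha>) / (\<alpha> - 1) * confluent_hyp (- real n - \<alpha> + 1) (2 - \<alpha>) (z j)
            - confluent_hyp (- real n - \<alpha>) (1 - \<alpha>) (z j))
         + cot (pi * \<alpha>) * z j powr (\<alpha> - 1) * exp (- z j) * (real n + \<alpha>)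
             * laguerre (n - 1) \<alpha> (z j))) (at (z j)))
    \<and> ((\<exists>p :: real poly. degree p \<le> n - 1 \<and> (\<forall>t\<ge>0. f t = poly p t)) \<longrightarrow> (\<forall>x>0. R x = 0))
    \<and> (\<forall>(M :: real poly) r. degree M \<le> n - 1 \<and> (\<forall>t\<ge>0. f t = poly M t + r t) \<longrightarrow>
        (\<forall>x>0. (\<forall>m\<in>{1..n}. x \<noteq> z m) \<longrightarrow>
          R x = - (\<Sum>m=1..n. quad_weight n \<alpha> (z m) * r (z m) / (x - z m) *
                      (laguerre_Q n \<alpha> x - laguerre_Q n \<alpha> (z m)))
                + 1 / pi * pv_integral (\<lambda>t. r t * laguerre_weight \<alpha> t / (t - x)) x))"
proof -
  interpret laguerre_nodes n \<alpha> z
    by unfold_locales (fact n alpha zeros)+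
  let ?w = "laguerre_weight \<alpha>" and ?Q = "laguerre_Q n \<alpha>" and ?c = "\<lambda>m. quad_weight n \<alpha> (z m)"
  \<comment> \<open>Both defining equations of the remainder in one. At x = z j the j-th summand is
    the derivative term; distinctness of the nodes keeps the other summands quotients.\<close>
  have rem: "singular_integral \<alpha> f x = (\<Sum>m=1..n. ?c m * f (z m) * divided_diff_Q m x) + R x" if "x > 0" for x
  proof (cases "\<exists>j\<in>{1..n}. x = z j")
    case True
    then obtain j where j: "j \<in> {1..n}" "x = z j" by blast
    have "(\<Sum>m=1..n. ?c m * f (z m) * divided_diff_Q m (z j))
        = ?c j * f (z j) * deriv ?Q (z j) + (\<Sum>m\<in>{1..n} - {j}. ?c m * f (z m) * ((?Q (z j) - ?Q (z m)) / (z j - z m)))"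
      using j(1) by (subst sum.remove[of _ j])
        (auto simp: divided_diff_Q_def node_inj intro!: sum.cong)
    then show ?thesis using remainder_node[OF j(1)] j(2) by simp
  next
    case False
    then have "(\<Sum>m=1..n. ?c m * f (z m) * divided_diff_Q m x)
        = (\<Sum>m=1..n. ?c m * f (z m) * ((?Q x - ?Q (z m)) / (x - z m)))"
      by (intro sum.cong) (auto simp: divided_diff_Q_def)
    then show ?thesis using remainder[OF that] False by simp
  qed
  \<comment> \<open>Without existence of this limit \<open>pv_integral\<close> would be an
    unspecified \<open>Lim\<close>, and nothing could be subtracted from it.\<close>
  have f_pv: "\<exists>L. has_pv (\<lambda>t. f t * ?w t / (t - x)) x L" if "x > 0" for x
    by (rule has_pv_holder[OF alpha that _ growth]) (use holder in blast)+
  have i: "(?Q has_real_derivative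
        (1 / pi * exp (- z j) * Gamma \<alpha> *
           ((real n + \<alpha>) / (\<alpha> - 1) * confluent_hyp (- real n - \<alpha> + 1) (2 - \<alpha>) (z j)
            - confluent_hyp (- real n - \<alpha>) (1 - \<alpha>) (z j))
         + cot (pi * \<alpha>) * z j powr (\<alpha> - 1) * exp (- z j) * (real n + \<alpha>)
             * laguerre (n - 1) \<alpha> (z j))) (at (z j))" if "j \<in> {1..n}" for j
    by (rule has_real_derivative_laguerre_Q[OF alpha(1) n node_pos[OF that] node_zero[OF that]])
  have ii: "R x = 0" if p: "degree p \<le> n - 1" "\<forall>t\<ge>0. f t = poly p t" and x: "x > 0" for p x
  proof -
    have "has_pv (\<lambda>t. f t * ?w t / (t - x)) x (pi * (\<Sum>m=1..n. ?c m * poly p (z m) * divided_diff_Q m x))"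
      by (rule has_pv_cong[OF has_pv_poly[OF p(1) x] x]) (use p(2) in simp)
    then have "singular_integral \<alpha> f x = (\<Sum>m=1..n. ?c m * poly p (z m) * divided_diff_Q m x)"
      unfolding singular_integral_def by (simp add: has_pv_pv_integral)
    also have "\<dots> = (\<Sum>m=1..n. ?c m * f (z m) * divided_diff_Q m x)"
      using p(2) node_pos by (intro sum.cong) (auto simp: less_imp_le)
    finally show ?thesis using rem[OF x] by simp
  qed
  have iii: "R x = - (\<Sum>m=1..n. ?c m * r (z m) / (x - z m) * (?Q x - ?Q (z m)))
                + 1 / pi * pv_integral (\<lambda>t. r t * ?w t / (t - x)) x"
    if M: "degree M \<le> n - 1" "\<forall>t\<ge>0. f t = poly M t + r t" and x: "x > 0" "\<forall>m\<in>{1..n}. x \<noteq> z m" for M r x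
  proof -
    let ?S = "\<Sum>m=1..n. ?c m * poly M (z m) * divided_diff_Q m x"
    obtain L where L: "has_pv (\<lambda>t. f t * ?w t / (t - x)) x L" using f_pv[OF x(1)] by blast
    \<comment> \<open>The existence of the principal value for \<open>r\<close> is derived, as the
      difference of those for \<open>f\<close> and for \<open>M\<close>.\<close>
    have "has_pv (\<lambda>t. r t * ?w t / (t - x)) x (L - pi * ?S)"
      by (rule has_pv_cong[OF has_pv_diff[OF L has_pv_poly[OF M(1) x(1)]] x(1)])
        (use M(2) in \<open>simp add: distrib_right add_divide_distrib\<close>)
    then have r: "1 / pi * pv_integral (\<lambda>t. r t * ?w t / (t - x)) x = L / pi - ?S"
      by (simp add: has_pv_pv_integral diff_divide_distrib)
    have "L / pi = (\<Sum>m=1..n. ?c m * f (z m) * divided_diff_Q m x) + R x"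
      using rem[OF x(1)] has_pv_pv_integral[OF L] by (simp add: singular_integral_def)
    also have "(\<Sum>m=1..n. ?c m * f (z m) * divided_diff_Q m x)
        = ?S + (\<Sum>m=1..n. ?c m * r (z m) / (x - z m) * (?Q x - ?Q (z m)))"
      unfolding sum.distrib[symmetric]
      by (intro sum.cong refl) (use M(2) x(2) node_pos in \<open>auto simp: divided_diff_Q_def less_imp_le algebra_simps\<close>)
    finally show ?thesis unfolding r by simp
  qed
  show ?thesis using i ii iii by blast
qed

end
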